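(* Every Kolmogorov system is a $J$-th order Wiener-Wintner system for every $J \in \mathbb{N}$.
   Context: A system $(X,\mathcal{F},\mu,T)$ is a probability space with a measure-preserving map $T$. Notation: $[M]=\{1,\dots,M\}$; $V_k=\{0,1\}^k$; for $\eta\in V_k$, $|\eta|=\sum_j\eta_j$ and $h\cdot\eta=\sum_j h_j\eta_j$; $c$ is complex conjugation, so $c^{|\eta|}g$ equals $g$ if $|\eta|$ is even and $\overline g$ if $|\eta|$ is odd. Kolmogorov system (K system): an invertible ergodic system whose Pinsker $\sigma$-algebra is trivial; that is, there is a sub-$\sigma$-algebra $\mathcal{A}\subset\mathcal{F}$ with $T^{-1}\mathcal{A}\subset\mathcal{A}$, $\bigcap_{n\in\mathbb{N}}T^{-n}\mathcal{A}$ trivial mod $\mu$, and $\bigvee_{n\in\mathbb{N}}T^n\mathcal{A}$ dense in $\mathcal{F}$ (equal to $\mathcal{F}$ mod $\mu$). Wiener-Wintner (WW) functions. Let $p\in[1,\infty]$, $\alpha>0$. A function $f\in L^\infty(\mu)$ is a first-order WW function of power type $\alpha$ in $L^p$ if there is $C_f>0$ with $\left\|\sup_{t\in\mathbb{R}}\left|\frac1N\sum_{n=1}^N e^{2\pi i n t}f\circ T^n\right|\right\|_p\le C_f N^{-\alpha}$ for all $N\in\mathbb{N}$. For $k\ge2$, $f\in L^\infty(\mu)$ is a $k$-th order WW function of power type $\alpha$ in $L^p$ if there is $C_f>0$ such that for all $N\in\mathbb{N}$ $$\frac{1}{\lfloor \sqrt{N} \rfloor^{k-1}} \sum_{h \in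 [\lfloor \sqrt{N} \rfloor]^{k-1}}\left\| \sup_{t\in\mathbb{R}} \left| \frac{1}{N} \sum_{n=1}^N e^{2\pi i n t} \left[\prod_{\eta\in V_{k-1}} c^{|\eta|} f \circ T^{h \cdot \eta} \right]\circ T^n \right| \right\|_p^{2/3} \leq \frac{C_f}{N^\alpha}.$$ Host-Kra-Ziegler factors. For an ergodic system and $f\in L^\infty(\mu)$ put $|||f|||_2^4=\lim_H\frac1H\sum_{h=1}^H\left|\int f\cdot\overline{f\circ T^h}\,d\mu\right|^2$ and, for $k\ge3$, $|||f|||_k^{2^k}=\lim_H\frac1H\sum_{h=1}^H|||f\cdot\overline{f\circ T^h}|||_{k-1}^{2^{k-1}}$. For $k\ge1$, $\mathcal{Z}_k$ is the $k$-th Host-Kra-Ziegler factor: the invariant sub-$\sigma$-algebra characterized by $\mathbb{E}(f|\mathcal{Z}_k)=0\iff|||f|||_{k+1}=0$ for $f\in L^\infty(\mu)$ ($\mathcal{Z}_1$ is the Kronecker factor). $L^2(\mathcal{Z}_k)^\perp=\{f\in L^2(\mu):\mathbb{E}(f|\mathcal{Z}_k)=0\}$. WW systems. An ergodic system is a $k$-th order WW system of power type $\alpha$ in $L^p$ if there is a set of $k$-th order WW functions of power type $\alpha$ in $L^p$ that is $L^2$-dense in $L^2(\mathcal{Z}_k)^\perp$. It is a $k$-th order WW system if this holds for some $\alpha>0$ and some $p\in[1,\infty]$. *)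

theory Defs
  imports "HOL-Probability.Probability" "HOL-Probability.Essential_Supremum"
begin

section \<open>Measure-preserving systems\<close>

locale mp_system = prob_space M for M :: "'a measure" +
  fixes T :: "'a \<Rightarrow> 'a"
  assumes T_measurable: "T \<in> measurable M M"
    and T_preserving: "distr M M T = M"

locale ergodic_system = mp_system +
  assumes ergodic: "\<And>B. B \<in> sets M \<Longrightarrow> T -` B \<inter> space M = B \<Longrightarrow> prob B = 0 \<or> prob B = 1"

locale invertible_system = mp_system +
  assumes T_bij: "bij_betw T (space M) (space M)"
    and T_inv_measurable: "the_inv_into (space M) T \<in> measurable M M"

definition preimage_sets :: "'a measure \<Rightarrow> ('a \<Rightarrow> 'a) \<Rightarrow> nat \<Rightarrow> 'a measure \<Rightarrow> 'a set set" where
  "preimage_sets M T n A = {(T ^^ n) -` B \<inter> space M | B. B \<in> sets A}"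

definition image_sets :: "('a \<Rightarrow> 'a) \<Rightarrow> nat \<Rightarrow> 'a measure \<Rightarrow> 'a set set" where
  "image_sets T n A = {(T ^^ n) ` B | B. B \<in> sets A}"

text \<open>
  Sub-\<open>\<sigma>\<close>-algebras are represented by measures \<open>A\<close> with \<^term>\<open>subalgebra M A\<close>; only
  their space and their measurable sets are relevant.
\<close>

locale kolmogorov_system = ergodic_system + invertible_system +
  assumes kolmogorov: "\<exists>A. subalgebra M A
    \<and> preimage_sets M T 1 A \<subseteq> sets A
    \<and> (\<forall>B \<in> (\<Inter>n. preimage_sets M T n A). prob B = 0 \<or> prob B = 1)
    \<and> (\<forall>B \<in> sets M. \<exists>C \<in> sigma_sets (space M) (\<Union>n. image_sets T n A).
          (B - C) \<union> (C - B) \<in> null_sets M)"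


section \<open>Function spaces\<close>

text \<open>
  Elements of the spaces are functions, not classes modulo null sets. The norm below is only
  meaningful for functions in the corresponding space; it is applied to essentially bounded
  functions on probability spaces and, for \<open>p = 2\<close>, to square-integrable functions.
\<close>

definition Lp_norm :: "'a measure \<Rightarrow> ereal \<Rightarrow> ('a \<Rightarrow> 'b::real_normed_vector) \<Rightarrow> real" where
  "Lp_norm M p f =
    (if p = \<infinity> then real_of_ereal (esssup M (\<lambda>x. ereal (norm (f x))))
     else (LINT x|M. norm (f x) powr real_of_ereal p) powr (1 / real_of_ereal p))"

definition Linf :: "'a measure \<Rightarrow> ('a \<Rightarrow> complex) set" where
  "Linf M = {f \<in> borel_measurable M. \<exists>C. AE x in M. norm (f x) \<le> C}"

definition L2 :: "'a measure \<Rightarrow> ('a \<Rightarrow> complex) set" where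
  "L2 M = {f \<in> borel_measurable M. integrable M (\<lambda>x. (norm (f x))\<^sup>2)}"

definition complex_cond_exp :: "'a measure \<Rightarrow> 'a measure \<Rightarrow> ('a \<Rightarrow> complex) \<Rightarrow> 'a \<Rightarrow> complex" where
  "complex_cond_exp M Z f x =
    Complex (real_cond_exp M Z (\<lambda>y. Re (f y)) x) (real_cond_exp M Z (\<lambda>y. Im (f y)) x)"

definition L2_perp :: "'a measure \<Rightarrow> 'a measure \<Rightarrow> ('a \<Rightarrow> complex) set" where
  "L2_perp M Z = {f \<in> L2 M. AE x in M. complex_cond_exp M Z f x = 0}"

definition L2_dense_in :: "'a measure \<Rightarrow> ('a \<Rightarrow> complex) set \<Rightarrow> ('a \<Rightarrow> complex) set \<Rightarrow> bool" where
  "L2_dense_in M S V \<longleftrightarrow>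
    S \<subseteq> V \<and> (\<forall>g \<in> V. \<forall>\<epsilon>>0. \<exists>f \<in> S. Lp_norm M 2 (\<lambda>x. g x - f x) < \<epsilon>)"


section \<open>Host-Kra-Ziegler factors\<close>

text \<open>
  The recursion starts from \<open>|||f|||\<^sub>1 = |\<integral>f d\<mu>|\<close>, so that its step yields exactly the usual
  formula for \<open>|||f|||\<^sub>2\<close>. Index \<open>0\<close> is not used. On ergodic systems
  and for \<open>f\<close> in \<^term>\<open>Linf M\<close> the limits exist.
\<close>

fun hk_seminorm :: "'a measure \<Rightarrow> ('a \<Rightarrow> 'a) \<Rightarrow> nat \<Rightarrow> ('a \<Rightarrow> complex) \<Rightarrow> real" where
  "hk_seminorm M T 0 f = undefined"
| "hk_seminorm M T (Suc 0) f = cmod (LINT x|M. f x)"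
| "hk_seminorm M T (Suc (Suc k)) f =
    root (2 ^ (k + 2)) (lim (\<lambda>H. (1 / real H) *
      (\<Sum>h=1..H. hk_seminorm M T (Suc k) (\<lambda>x. f x * cnj (f ((T ^^ h) x))) ^ (2 ^ (k + 1)))))"

text \<open>
  The \<open>k\<close>-th factor is determined by this predicate only up to null sets, and
  \<^term>\<open>L2_perp M Z\<close> does not depend on the choice of \<open>Z\<close>.
\<close>

definition hkz_factor :: "'a measure \<Rightarrow> ('a \<Rightarrow> 'a) \<Rightarrow> nat \<Rightarrow> 'a measure \<Rightarrow> bool" where
  "hkz_factor M T k Z \<longleftrightarrow>
    subalgebra M Z \<and> preimage_sets M T 1 Z \<subseteq> sets Z \<and>
    (\<forall>f \<in> Linf M. (AE x in M. complex_cond_exp M Z f x = 0) \<longleftrightarrow> hk_seminorm M T (k + 1) f = 0)"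


section \<open>Wiener-Wintner functions and systems\<close>

definition ww_sup :: "('a \<Rightarrow> 'a) \<Rightarrow> nat \<Rightarrow> ('a \<Rightarrow> complex) \<Rightarrow> 'a \<Rightarrow> real" where
  "ww_sup T N g x = (SUP t::real.
     cmod ((1 / of_nat N) *
       (\<Sum>n=1..N. exp (2 * of_real pi * \<i> * of_nat n * of_real t) * g ((T ^^ n) x))))"

text \<open>Elements of \<open>[M]\<^sup>k\<close> and of \<open>V\<^sub>k = {0,1}\<^sup>k\<close> are extensional functions on \<open>{..<k}\<close>.\<close>

definition box :: "nat \<Rightarrow> nat \<Rightarrow> (nat \<Rightarrow> nat) set" where
  "box M k = {..<k} \<rightarrow>\<^sub>E {1..M}"

definition cube :: "nat \<Rightarrow> (nat \<Rightarrow> nat) set" where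
  "cube k = {..<k} \<rightarrow>\<^sub>E {0, 1}"

definition cube_product ::
  "('a \<Rightarrow> 'a) \<Rightarrow> nat \<Rightarrow> (nat \<Rightarrow> nat) \<Rightarrow> ('a \<Rightarrow> complex) \<Rightarrow> 'a \<Rightarrow> complex" where
  "cube_product T k h f x =
    (\<Prod>\<eta>\<in>cube k. (cnj ^^ (\<Sum>j<k. \<eta> j)) (f ((T ^^ (\<Sum>j<k. h j * \<eta> j)) x)))"

definition ww_function_1 ::
  "'a measure \<Rightarrow> ('a \<Rightarrow> 'a) \<Rightarrow> real \<Rightarrow> ereal \<Rightarrow> ('a \<Rightarrow> complex) \<Rightarrow> bool" where
  "ww_function_1 M T \<alpha> p f \<longleftrightarrow>
    f \<in> Linf M \<and> (\<exists>C>0. \<forall>N\<ge>1. Lp_norm M p (ww_sup T N f) \<le> C * real N powr (-\<alpha>))"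

definition ww_function_ge2 ::
  "'a measure \<Rightarrow> ('a \<Rightarrow> 'a) \<Rightarrow> nat \<Rightarrow> real \<Rightarrow> ereal \<Rightarrow> ('a \<Rightarrow> complex) \<Rightarrow> bool" where
  "ww_function_ge2 M T k \<alpha> p f \<longleftrightarrow>
    f \<in> Linf M \<and> (\<exists>C>0. \<forall>N\<ge>1.
      (let R = nat \<lfloor>sqrt (real N)\<rfloor> in
        (1 / real R ^ (k - 1)) *
          (\<Sum>h\<in>box R (k - 1). Lp_norm M p (ww_sup T N (cube_product T (k - 1) h f)) powr (2 / 3)))
      \<le> C / real N powr \<alpha>)"

definition ww_function ::
  "'a measure \<Rightarrow> ('a \<Rightarrow> 'a) \<Rightarrow> nat \<Rightarrow> real \<Rightarrow> ereal \<Rightarrow> ('a \<Rightarrow> complex) \<Rightarrow> bool" where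
  "ww_function M T k \<alpha> p f \<longleftrightarrow>
    (k = 1 \<and> ww_function_1 M T \<alpha> p f) \<or> (k \<ge> 2 \<and> ww_function_ge2 M T k \<alpha> p f)"

definition ww_system_type ::
  "'a measure \<Rightarrow> ('a \<Rightarrow> 'a) \<Rightarrow> nat \<Rightarrow> real \<Rightarrow> ereal \<Rightarrow> bool" where
  "ww_system_type M T k \<alpha> p \<longleftrightarrow>
    ergodic_system M T \<and>
    (\<exists>Z. hkz_factor M T k Z \<and>
      (\<exists>S. (\<forall>f\<in>S. ww_function M T k \<alpha> p f) \<and> L2_dense_in M S (L2_perp M Z)))"

definition ww_system :: "'a measure \<Rightarrow> ('a \<Rightarrow> 'a) \<Rightarrow> nat \<Rightarrow> bool" where
  "ww_system M T k \<longleftrightarrow> (\<exists>\<alpha>>0. \<exists>p\<ge>1. ww_system_type M T k \<alpha> p)"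

end

theory Submission
  imports Defs
begin

text \<open>
  Let \<open>A\<close> be the \<open>\<sigma>\<close>-algebra witnessing the K property. A bounded function \<open>f\<close> that is measurable
  for \<open>T\<^sup>n A\<close> and orthogonal to \<open>T\<^bsup>n-L\<^esup> A\<close> behaves like an \<open>L\<close>-dependent martingale difference:
  \<open>f \<circ> T\<^sup>m\<close> and \<open>f \<circ> T\<^bsup>m+r\<^esup>\<close> are orthogonal for \<open>r \<ge> L\<close>, and products
  \<open>f \<cdot> (u \<circ> T\<^sup>r)\<close> with \<open>u\<close> measurable for \<open>T\<^sup>n A\<close> and \<open>r \<ge> L\<close> are of the same kind. Expanding
  the square of a modulated Birkhoff sum into correlations, each of which is again a sum of almost
  orthogonal terms, bounds the supremum over \<open>t\<close> by \<open>O(N\<^bsup>-1/4\<^esup>)\<close> in \<open>L\<^sup>2\<close>. A cube product with all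
  \<open>h\<^sub>j \<ge> L\<close> is such a function, and the remaining \<open>h\<close> are a proportion \<open>O(N\<^bsup>-1/2\<^esup>)\<close>, so \<open>f\<close> is a
  Wiener-Wintner function of power type \<open>1/6\<close> in \<open>L\<^sup>2\<close> for every order.

  Reverse martingale convergence along the trivial tail shows that these functions are dense among the
  centred ones. Density gives mixing, by which every seminorm \<open>|||f|||\<^sub>k\<close> equals \<open>|\<integral>f d\<mu>|\<close>, so all
  Host-Kra-Ziegler factors are trivial.
\<close>

section \<open>Wiener-Wintner bounds for innovations\<close>

lemma bounded_range_iff: "bounded (range f) \<longleftrightarrow> (\<exists>K\<ge>0. \<forall>x. norm (f x) \<le> K)"
  for f :: "'a \<Rightarrow> 'b::real_normed_vector"
  by (auto simp: bounded_iff) (meson norm_ge_zero order_trans)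

lemma bounded_range_mult:
  fixes f g :: "'a \<Rightarrow> 'b::real_normed_algebra"
  assumes "bounded (range f)" "bounded (range g)"
  shows "bounded (range (\<lambda>x. f x * g x))"
proof -
  obtain K L where "K \<ge> 0" "\<And>x. norm (f x) \<le> K" "L \<ge> 0" "\<And>x. norm (g x) \<le> L"
    using assms by (auto simp: bounded_range_iff)
  then have "norm (f x * g x) \<le> K * L" for x
    by (meson mult_mono norm_ge_zero norm_mult_ineq order_trans)
  then show ?thesis
    using \<open>K \<ge> 0\<close> \<open>L \<ge> 0\<close> by (auto simp: bounded_range_iff intro!: exI[of _ "K * L"])
qed

lemma bounded_range_add:
  fixes f g :: "'a \<Rightarrow> 'b::real_normed_vector"
  assumes "bounded (range f)" "bounded (range g)"
  shows "bounded (range (\<lambda>x. f x + g x))"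
proof -
  obtain K L where "K \<ge> 0" "\<And>x. norm (f x) \<le> K" "L \<ge> 0" "\<And>x. norm (g x) \<le> L"
    using assms by (auto simp: bounded_range_iff)
  then have "norm (f x + g x) \<le> K + L" for x
    by (meson add_mono norm_triangle_ineq order_trans)
  then show ?thesis
    using \<open>K \<ge> 0\<close> \<open>L \<ge> 0\<close> by (auto simp: bounded_range_iff intro!: exI[of _ "K + L"])
qed

lemma bounded_range_compose: "bounded (range f) \<Longrightarrow> bounded (range (\<lambda>x. f (g x)))"
  by (erule bounded_subset) auto

lemma bounded_range_cnj: "bounded (range f) \<Longrightarrow> bounded (range (\<lambda>x. cnj (f x)))"
  by (auto simp: bounded_range_iff)

lemma (in finite_measure) integrable_bounded_range:
  fixes f :: "'a \<Rightarrow> 'b::{banach, second_countable_topology}"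
  assumes "f \<in> borel_measurable M" "bounded (range f)"
  shows "integrable M f"
proof -
  obtain K where "\<And>x. norm (f x) \<le> K"
    using assms(2) by (auto simp: bounded_range_iff)
  then show ?thesis
    using assms(1) by (intro integrable_const_bound[of _ K]) auto
qed

lemma borel_measurable_cnj [measurable (raw)]:
  "f \<in> borel_measurable M \<Longrightarrow> (\<lambda>x. cnj (f x)) \<in> borel_measurable M"
  by (rule borel_measurable_continuous_on[OF continuous_on_cnj[OF continuous_on_id]])

text \<open>Group the pairs of the double sum by their lag \<open>r\<close>. The lags
  \<open>r\<close> and \<open>-r\<close> contribute conjugate terms, hence the doubled real part.
  Passing from \<open>N\<close> to \<open>Suc N\<close> adds to each lag the one pair that ends at
  \<open>Suc N\<close>.\<close>

lemma norm_sum_square_eq: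
  fixes a :: "nat \<Rightarrow> complex"
  shows "(cmod (\<Sum>n=1..N. a n))\<^sup>2 = (\<Sum>n=1..N. (cmod (a n))\<^sup>2)
    + 2 * Re (\<Sum>r=1..N. \<Sum>n=1..N-r. a n * cnj (a (n + r)))"
proof (induction N)
  case (Suc N)
  \<comment> \<open>The new lag \<open>r = Suc N\<close> has an empty inner sum.\<close>
  have "(\<Sum>r=1..Suc N. \<Sum>n=1..Suc N-r. a n * cnj (a (n + r)))
      = (\<Sum>r=1..N. \<Sum>n=1..Suc N-r. a n * cnj (a (n + r)))"
    by simp
  also have "\<dots> = (\<Sum>r=1..N. (\<Sum>n=1..N-r. a n * cnj (a (n + r))) + a (Suc N - r) * cnj (a (Suc N)))"
    by (intro sum.cong) (auto simp: Suc_diff_le)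
  also have "\<dots> = (\<Sum>r=1..N. \<Sum>n=1..N-r. a n * cnj (a (n + r)))
      + (\<Sum>r=1..N. a (Suc N - r) * cnj (a (Suc N)))"
    by (rule sum.distrib)
  also have "(\<Sum>r=1..N. a (Suc N - r) * cnj (a (Suc N))) = (\<Sum>r=1..N. a r * cnj (a (Suc N)))"
    by (rule sum.reindex_bij_witness[of _ "\<lambda>r. Suc N - r" "\<lambda>r. Suc N - r"]) auto
  finally have *: "(\<Sum>r=1..Suc N. \<Sum>n=1..Suc N-r. a n * cnj (a (n + r)))
      = (\<Sum>r=1..N. \<Sum>n=1..N-r. a n * cnj (a (n + r))) + (\<Sum>r=1..N. a r) * cnj (a (Suc N))"
    by (simp add: sum_distrib_right)
  have "(cmod (s + b))\<^sup>2 = (cmod s)\<^sup>2 + (cmod b)\<^sup>2 + 2 * Re (s * cnj b)" for s b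
    unfolding cmod_power2 by (simp add: power2_eq_square algebra_simps)
  then show ?case
    using Suc.IH unfolding * by (simp add: algebra_simps)
qed simp

text \<open>The modulation cancels inside each correlation sum, so the bound is uniform in \<open>t\<close>.\<close>
lemma modulated_sum_square_le:
  fixes a :: "nat \<Rightarrow> complex"
  shows "(cmod (\<Sum>n=1..N. exp (2 * of_real pi * \<i> * of_nat n * of_real t) * a n))\<^sup>2
    \<le> (\<Sum>n=1..N. (cmod (a n))\<^sup>2) + 2 * (\<Sum>r=1..N. cmod (\<Sum>n=1..N-r. a n * cnj (a (n + r))))"
proof -
  define e where "e n = exp (2 * of_real pi * \<i> * of_nat n * of_real t)" for n :: nat
  have norm_e: "cmod (e n) = 1" for n
    by (simp add: e_def)
  have "e (n + r) = e n * e r" for n r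
    by (simp add: e_def exp_add[symmetric] algebra_simps)
  moreover have "e n * cnj (e n) = 1" for n
    using norm_e[of n] by (simp add: complex_norm_square[symmetric])
  ultimately have "e n * a n * cnj (e (n + r) * a (n + r)) = cnj (e r) * (a n * cnj (a (n + r)))" for n r
    by (simp add: algebra_simps)
  then have "(\<Sum>n=1..N-r. e n * a n * cnj (e (n + r) * a (n + r)))
      = cnj (e r) * (\<Sum>n=1..N-r. a n * cnj (a (n + r)))" for r
    unfolding sum_distrib_left by (rule sum.cong[OF refl])
  then have "cmod (\<Sum>n=1..N-r. e n * a n * cnj (e (n + r) * a (n + r)))
      = cmod (\<Sum>n=1..N-r. a n * cnj (a (n + r)))" for r
    by (simp only: norm_mult complex_mod_cnj norm_e mult_1)
  then have "Re (\<Sum>r=1..N. \<Sum>n=1..N-r. e n * a n * cnj (e (n + r) * a (n + r)))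
      \<le> (\<Sum>r=1..N. cmod (\<Sum>n=1..N-r. a n * cnj (a (n + r))))"
    by (intro order_trans[OF complex_Re_le_cmod] order_trans[OF norm_sum]) (simp del: complex_cnj_mult)
  then show ?thesis
    using norm_sum_square_eq[of "\<lambda>n. e n * a n" N]
    by (simp add: norm_mult norm_e flip: e_def)
qed

section \<open>Iterates of a measure-preserving map\<close>

context mp_system
begin

lemma T_pow_measurable [measurable]: "T ^^ n \<in> measurable M M"
  using T_measurable by (rule measurable_compose_n)

lemma T_pow_preserving: "distr M M (T ^^ n) = M"
proof (induction n)
  case 0
  then show ?case by (simp add: distr_id2)
next
  case (Suc n)
  have "distr M M (T ^^ Suc n) = distr (distr M M (T ^^ n)) M T"
    by (subst distr_distr[OF T_measurable]) simp_all
  then show ?case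
    by (simp only: Suc T_preserving)
qed

lemma integral_T_pow:
  fixes f :: "'a \<Rightarrow> 'b::{banach, second_countable_topology}"
  assumes "f \<in> borel_measurable M"
  shows "(LINT x|M. f ((T ^^ n) x)) = (LINT x|M. f x)"
  using integral_distr[of "T ^^ n" M M f] assms by (simp add: T_pow_preserving)

lemma integrable_T_pow:
  fixes f :: "'a \<Rightarrow> 'b::{banach, second_countable_topology}"
  assumes "integrable M f"
  shows "integrable M (\<lambda>x. f ((T ^^ n) x))"
  using integrable_distr[of "T ^^ n" M M f] assms by (simp add: T_pow_preserving)

lemma AE_T_pow: "AE x in M. P x \<Longrightarrow> AE x in M. P ((T ^^ n) x)"
  by (rule AE_distrD[OF T_pow_measurable], subst T_pow_preserving)

end

section \<open>Innovations of an invariant sub-sigma-algebra\<close>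

text \<open>Measurability of \<open>T\<close> for \<open>B\<close> makes the preimages of
  \<open>B\<close> under \<open>T ^^ n\<close> decrease in \<open>n\<close>. Later \<open>B\<close>
  is taken to be each of the algebras T^n A.\<close>

locale invariant_subalgebra = mp_system +
  fixes B :: "'a measure"
  assumes subalgebra: "subalgebra M B"
    and T_measurable_B: "T \<in> measurable B B"
begin

lemma measurable_B_M: "f \<in> borel_measurable B \<Longrightarrow> f \<in> borel_measurable M"
  by (rule measurable_from_subalg[OF subalgebra])

lemma T_pow_measurable_B [measurable]: "T ^^ n \<in> measurable B B"
  using T_measurable_B by (rule measurable_compose_n)

text \<open>The last condition says \<open>E(f | T\<^bsup>-L\<^esup> B) = 0\<close>, phrased by test functions.\<close>
definition innovation :: "nat \<Rightarrow> ('a \<Rightarrow> complex) set" where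
  "innovation L = {f \<in> borel_measurable B. bounded (range f) \<and>
    (\<forall>g\<in>borel_measurable B. bounded (range g) \<longrightarrow> (LINT x|M. f x * g ((T ^^ L) x)) = 0)}"

lemma innovationD:
  assumes "f \<in> innovation L"
  shows "f \<in> borel_measurable B" "bounded (range f)" "f \<in> borel_measurable M"
  using assms measurable_B_M by (auto simp: innovation_def)

text \<open>Since \<open>r \<ge> L\<close>, the new factor is a function of
  \<open>(T ^^ L) x\<close>, namely \<open>u\<close> composed with \<open>T ^^ (r - L)\<close>. It
  can therefore be absorbed into the test function.\<close>

lemma innovation_mult:
  assumes f: "f \<in> innovation L" and u[measurable]: "u \<in> borel_measurable B"
    and bu: "bounded (range u)" and "r \<ge> L"
  shows "(\<lambda>x. f x * u ((T ^^ r) x)) \<in> innovation L"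
proof -
  have [measurable]: "f \<in> borel_measurable B"
    using innovationD[OF f] by auto
  have "(LINT x|M. f x * u ((T ^^ r) x) * g ((T ^^ L) x)) = 0"
    if [measurable]: "g \<in> borel_measurable B" and bg: "bounded (range g)" for g
  proof -
    let ?g = "\<lambda>x. u ((T ^^ (r - L)) x) * g x"
    have "?g \<in> borel_measurable B" "bounded (range ?g)"
      using bg bu by (auto intro: bounded_range_mult bounded_range_compose)
    with f have "(LINT x|M. f x * ?g ((T ^^ L) x)) = 0"
      unfolding innovation_def by blast
    moreover have "(T ^^ (r - L)) ((T ^^ L) x) = (T ^^ r) x" for x
      using \<open>r \<ge> L\<close> by (metis comp_apply funpow_add le_add_diff_inverse2)
    ultimately show ?thesis
      by (simp add: mult.assoc)
  qed
  then show ?thesis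
    using innovationD[OF f] bu by (auto simp: innovation_def bounded_range_mult bounded_range_compose)
qed

lemma innovation_mult_prod:
  assumes "f \<in> innovation L" "finite I"
    and "\<And>i. i \<in> I \<Longrightarrow> u i \<in> borel_measurable B \<and> bounded (range (u i)) \<and> r i \<ge> L"
  shows "(\<lambda>x. f x * (\<Prod>i\<in>I. u i ((T ^^ r i) x))) \<in> innovation L"
  using assms(2,3)
proof (induction I)
  case empty
  then show ?case using assms(1) by simp
next
  case (insert i I)
  then have "(\<lambda>x. f x * (\<Prod>i\<in>I. u i ((T ^^ r i) x)) * u i ((T ^^ r i) x)) \<in> innovation L"
    by (intro innovation_mult) auto
  then show ?case
    using insert.hyps by (simp add: mult.assoc mult.left_commute mult.commute)
qed

text \<open>By \<open>innovation_mult\<close> the product of \<open>f\<close> with its conjugate at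
  lag \<open>r\<close> is an innovation, and the test function 1 gives it integral zero. Invariance
  of the measure handles the shift by \<open>n\<close>.\<close>

lemma innovation_gap:
  assumes f: "f \<in> innovation L" and "r \<ge> L"
  shows "(LINT x|M. f ((T ^^ n) x) * cnj (f ((T ^^ (n + r)) x))) = 0"
proof -
  have [measurable]: "f \<in> borel_measurable B" "f \<in> borel_measurable M"
    using innovationD[OF f] by auto
  have "(\<lambda>x. f x * cnj (f ((T ^^ r) x))) \<in> innovation L"
    using innovation_mult[OF f _ _ \<open>r \<ge> L\<close>, of "\<lambda>x. cnj (f x)"] innovationD[OF f]
    by (auto intro: bounded_range_cnj)
  then have "(LINT x|M. f x * cnj (f ((T ^^ r) x))) = 0"
    unfolding innovation_def by (auto dest!: bspec[of _ _ "\<lambda>_. 1"])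
  then show ?thesis
    using integral_T_pow[of "\<lambda>x. f x * cnj (f ((T ^^ r) x))" n]
    by (simp add: funpow_add funpow_swap1 add.commute[of n r])
qed

text \<open>After integration only the lags below \<open>L\<close> survive in the expansion of the
  square, so it grows linearly in \<open>N\<close>, as for a martingale.\<close>

lemma innovation_sum_square:
  assumes f: "f \<in> innovation L" and K: "\<And>x. cmod (f x) \<le> K" and "L \<ge> 1"
  shows "(LINT x|M. (cmod (\<Sum>n=1..N. f ((T ^^ n) x)))\<^sup>2) \<le> 2 * real L * real N * K\<^sup>2"
proof -
  have [measurable]: "f \<in> borel_measurable M" and bf: "bounded (range f)"
    using innovationD[OF f] by auto
  have "K \<ge> 0"
    using K norm_ge_zero order_trans by blast
  have i2: "integrable M (\<lambda>x. f ((T ^^ n) x) * cnj (f ((T ^^ m) x)))" for n m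
    by (rule integrable_bounded_range)
       (auto intro!: bounded_range_mult bounded_range_cnj bounded_range_compose[where f=f] bf)
  have i1: "integrable M (\<lambda>x. (cmod (f ((T ^^ n) x)))\<^sup>2)" for n
    unfolding power2_eq_square
    by (intro integrable_bounded_range bounded_range_mult)
       (auto simp: bounded_norm_comp intro!: bounded_range_compose[where f=f] bf)
  have le: "cmod (LINT x|M. f ((T ^^ n) x) * cnj (f ((T ^^ m) x))) \<le> K\<^sup>2" for n m
  proof -
    have "cmod (LINT x|M. f ((T ^^ n) x) * cnj (f ((T ^^ m) x))) \<le>
        (LINT x|M. cmod (f ((T ^^ n) x) * cnj (f ((T ^^ m) x))))"
      by (rule integral_norm_bound)
    also have "\<dots> \<le> (LINT x|M. K\<^sup>2)"
      using K \<open>K \<ge> 0\<close> by (intro integral_mono') (auto simp: norm_mult power2_eq_square intro!: mult_mono)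
    finally show ?thesis by (simp add: prob_space)
  qed
  have le': "Re (LINT x|M. f ((T ^^ n) x) * cnj (f ((T ^^ (n + r)) x))) \<le> (if r < L then K\<^sup>2 else 0)" for n r
    using innovation_gap[OF f, of r n] order_trans[OF complex_Re_le_cmod le] by auto
  have le1: "(LINT x|M. (cmod (f ((T ^^ n) x)))\<^sup>2) \<le> K\<^sup>2" for n
  proof -
    have "(LINT x|M. (cmod (f ((T ^^ n) x)))\<^sup>2) \<le> (LINT x|M. K\<^sup>2)"
      using K \<open>K \<ge> 0\<close> by (intro integral_mono') (auto intro!: power_mono)
    then show ?thesis by (simp add: prob_space)
  qed
  have "(LINT x|M. (cmod (\<Sum>n=1..N. f ((T ^^ n) x)))\<^sup>2)
      = (\<Sum>n=1..N. LINT x|M. (cmod (f ((T ^^ n) x)))\<^sup>2)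
        + 2 * (\<Sum>r=1..N. \<Sum>n=1..N-r. Re (LINT x|M. f ((T ^^ n) x) * cnj (f ((T ^^ (n + r)) x))))"
  proof -
    have "(LINT x|M. (cmod (\<Sum>n=1..N. f ((T ^^ n) x)))\<^sup>2)
      = (LINT x|M. (\<Sum>n=1..N. (cmod (f ((T ^^ n) x)))\<^sup>2)
        + 2 * (\<Sum>r=1..N. \<Sum>n=1..N-r. Re (f ((T ^^ n) x) * cnj (f ((T ^^ (n + r)) x)))))"
      unfolding norm_sum_square_eq Re_sum ..
    also have "\<dots> = (LINT x|M. (\<Sum>n=1..N. (cmod (f ((T ^^ n) x)))\<^sup>2))
        + (LINT x|M. 2 * (\<Sum>r=1..N. \<Sum>n=1..N-r. Re (f ((T ^^ n) x) * cnj (f ((T ^^ (n + r)) x)))))"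
      by (intro Bochner_Integration.integral_add Bochner_Integration.integrable_sum
          integrable_mult_right integrable_Re i1 i2)
    also have "(LINT x|M. (\<Sum>n=1..N. (cmod (f ((T ^^ n) x)))\<^sup>2)) = (\<Sum>n=1..N. LINT x|M. (cmod (f ((T ^^ n) x)))\<^sup>2)"
      by (intro Bochner_Integration.integral_sum i1)
    also have "(LINT x|M. 2 * (\<Sum>r=1..N. \<Sum>n=1..N-r. Re (f ((T ^^ n) x) * cnj (f ((T ^^ (n + r)) x)))))
       = 2 * (\<Sum>r=1..N. LINT x|M. (\<Sum>n=1..N-r. Re (f ((T ^^ n) x) * cnj (f ((T ^^ (n + r)) x)))))"
      unfolding integral_mult_right_zero
      by (intro arg_cong[where f="(*) 2"] Bochner_Integration.integral_sum
          Bochner_Integration.integrable_sum integrable_Re i2)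
    also have "\<dots> = 2 * (\<Sum>r=1..N. \<Sum>n=1..N-r. LINT x|M. Re (f ((T ^^ n) x) * cnj (f ((T ^^ (n + r)) x))))"
      by (intro arg_cong[where f="(*) 2"] sum.cong refl Bochner_Integration.integral_sum integrable_Re i2)
    finally show ?thesis
      unfolding integral_Re[OF i2] .
  qed
  also have "\<dots> \<le> (\<Sum>n=1..N. K\<^sup>2) + 2 * (\<Sum>r=1..N. \<Sum>n=1..N-r. (if r < L then K\<^sup>2 else 0))"
    by (intro add_mono mult_left_mono sum_mono le1 le') auto
  also have "\<dots> \<le> real N * K\<^sup>2 + 2 * (\<Sum>r=1..N. (if r < L then real N * K\<^sup>2 else 0))"
    by (auto intro!: sum_mono mult_right_mono)
  also have "(\<Sum>r=1..N. (if r < L then real N * K\<^sup>2 else 0)) = (\<Sum>r\<in>{r\<in>{1..N}. r < L}. real N * K\<^sup>2)"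
    by (rule sum.inter_filter[symmetric]) auto
  also have "\<dots> \<le> (\<Sum>r\<in>{1..<L}. real N * K\<^sup>2)"
    by (intro sum_mono2) auto
  also have "\<dots> = (real L - 1) * real N * K\<^sup>2"
    using \<open>L \<ge> 1\<close> by (simp add: of_nat_diff)
  \<comment> \<open>The diagonal costs \<open>N\<close> terms and each of the \<open>L - 1\<close>
    surviving lags at most \<open>2 * N\<close>, in total at most
    \<open>(2 * L - 1) * N\<close>.\<close>
  finally have "(LINT x|M. (cmod (\<Sum>n=1..N. f ((T ^^ n) x)))\<^sup>2)
      \<le> real N * K\<^sup>2 + 2 * ((real L - 1) * real N * K\<^sup>2)" by simp
  also have "\<dots> \<le> 2 * real L * real N * K\<^sup>2"
    by (simp add: algebra_simps)
  finally show ?thesis .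
qed

end

section \<open>Norm bounds for the modulated supremum\<close>

text \<open>The variance is nonnegative. This is the passage from L^2 to L^1 used
  throughout.\<close>

lemma (in prob_space) expectation_le_sqrt:
  fixes X :: "'a \<Rightarrow> real"
  assumes "integrable M X" "integrable M (\<lambda>x. (X x)\<^sup>2)"
  shows "expectation X \<le> sqrt (expectation (\<lambda>x. (X x)\<^sup>2))"
  using variance_eq[OF assms] variance_positive[of X] by (intro real_le_rsqrt) simp

text \<open>For non-measurable \<open>f\<close> the left-hand side is the junk value \<open>0\<close>.\<close>
lemma Lp_norm_2_le:
  assumes "integrable M g" "\<And>x. x \<in> space M \<Longrightarrow> (norm (f x))\<^sup>2 \<le> g x" "(LINT x|M. g x) \<le> c"
  shows "Lp_norm M 2 f \<le> c powr (1/2)"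
proof -
  have "(LINT x|M. norm (f x) powr 2) = (LINT x|M. (norm (f x))\<^sup>2)"
    by simp
  also have "\<dots> \<le> (LINT x|M. g x)"
    using assms(2) by (intro integral_mono' assms(1)) (auto intro: order_trans[OF zero_le_power2])
  finally show ?thesis
    using assms(3) by (auto simp: Lp_norm_def intro!: powr_mono2)
qed

text \<open>A real \<open>SUP\<close> is meaningful only over a set bounded above. The bound uniform
  in \<open>t\<close> ensures this, and a single \<open>t\<close> then gives nonnegativity.\<close>

lemma ww_sup_bounds:
  assumes "\<And>t. cmod (1 / of_nat N * (\<Sum>n=1..N. exp (2 * of_real pi * \<i> * of_nat n * of_real t) * g ((T ^^ n) x))) \<le> c"
  shows "0 \<le> ww_sup T N g x" "ww_sup T N g x \<le> c"
proof -
  show "ww_sup T N g x \<le> c"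
    unfolding ww_sup_def using assms by (intro cSUP_least) auto
  show "0 \<le> ww_sup T N g x"
    unfolding ww_sup_def using assms by (intro cSUP_upper2[of _ _ 0] bdd_aboveI2) auto
qed

lemma ww_sup_le_bound:
  assumes "\<And>x. cmod (g x) \<le> K" "N \<ge> 1"
  shows "0 \<le> ww_sup T N g x" "ww_sup T N g x \<le> K"
proof -
  have "cmod (1 / of_nat N * (\<Sum>n=1..N. exp (2 * of_real pi * \<i> * of_nat n * of_real t) * g ((T ^^ n) x))) \<le> K" for t
  proof -
    have "cmod (\<Sum>n=1..N. exp (2 * of_real pi * \<i> * of_nat n * of_real t) * g ((T ^^ n) x)) \<le> (\<Sum>n=1..N. K)"
      using assms by (intro sum_norm_le) (simp add: norm_mult)
    then show ?thesis
      using assms(2) by (simp add: norm_mult norm_divide field_simps)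
  qed
  then show "0 \<le> ww_sup T N g x" "ww_sup T N g x \<le> K"
    by (rule ww_sup_bounds)+
qed

text \<open>The bound without cancellation, for those \<open>h\<close> that have a coordinate below
  \<open>L\<close>.\<close>

lemma (in prob_space) Lp_norm_ww_sup_le_bound:
  assumes "\<And>x. cmod (g x) \<le> K" "N \<ge> 1"
  shows "Lp_norm M 2 (ww_sup T N g) \<le> K"
proof -
  have "K \<ge> 0"
    using assms(1) norm_ge_zero order_trans by blast
  have "Lp_norm M 2 (ww_sup T N g) \<le> (K\<^sup>2) powr (1/2)"
    using ww_sup_le_bound[of g K N T] assms
    by (intro Lp_norm_2_le[of _ "\<lambda>_. K\<^sup>2"]) (auto simp: prob_space intro!: power_mono)
  then show ?thesis
    using \<open>K \<ge> 0\<close> by (simp add: powr_half_sqrt)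
qed

lemma Lp_norm_nonneg: "Lp_norm M 2 f \<ge> 0"
  by (simp add: Lp_norm_def)

context invariant_subalgebra
begin

text \<open>For \<open>r \<ge> L\<close> the correlation function \<open>G\<close> is itself an
  innovation, so \<open>innovation_sum_square\<close> applies to it and yields square root growth in
  \<open>m\<close>. The fewer than \<open>L\<close> positive lags below \<open>L\<close> get the
  trivial bound.\<close>

lemma innovation_correlation:
  assumes f: "f \<in> innovation L" and K: "\<And>x. cmod (f x) \<le> K" and "L \<ge> 1"
  shows "(LINT x|M. cmod (\<Sum>n=1..m. f ((T ^^ n) x) * cnj (f ((T ^^ (n + r)) x))))
    \<le> (if r < L then real m * K\<^sup>2 else sqrt (2 * real L * real m) * K\<^sup>2)"
proof -
  have [measurable]: "f \<in> borel_measurable M" "f \<in> borel_measurable B" and bf: "bounded (range f)"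
    using innovationD[OF f] by auto
  have "K \<ge> 0"
    using K norm_ge_zero order_trans by blast
  define G where "G x = f x * cnj (f ((T ^^ r) x))" for x
  have G_eq: "f ((T ^^ n) x) * cnj (f ((T ^^ (n + r)) x)) = G ((T ^^ n) x)" for n x
    by (simp add: G_def add.commute[of n r] funpow_add)
  have [measurable]: "G \<in> borel_measurable M"
    unfolding G_def by measurable
  have KG: "cmod (G x) \<le> K\<^sup>2" for x
    using K \<open>K \<ge> 0\<close> by (auto simp: G_def norm_mult power2_eq_square intro!: mult_mono)
  have sum_le: "cmod (\<Sum>n=1..m. G ((T ^^ n) x)) \<le> real m * K\<^sup>2" for x
  proof -
    have "cmod (\<Sum>n=1..m. G ((T ^^ n) x)) \<le> (\<Sum>n=1..m. K\<^sup>2)"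
      by (intro sum_norm_le KG)
    then show ?thesis by simp
  qed
  then have int1: "integrable M (\<lambda>x. cmod (\<Sum>n=1..m. G ((T ^^ n) x)))"
    by (intro integrable_const_bound[of _ "real m * K\<^sup>2"]) auto
  have int2: "integrable M (\<lambda>x. (cmod (\<Sum>n=1..m. G ((T ^^ n) x)))\<^sup>2)"
    using sum_le by (intro integrable_const_bound[of _ "(real m * K\<^sup>2)\<^sup>2"]) (auto intro!: power_mono)
  show ?thesis
  proof (cases "r < L")
    case True
    have "(LINT x|M. cmod (\<Sum>n=1..m. G ((T ^^ n) x))) \<le> (LINT x|M. real m * K\<^sup>2)"
      using sum_le by (intro integral_mono int1) auto
    then show ?thesis
      using True by (simp add: G_eq prob_space)
  next
    case False
    then have "G \<in> innovation L"
      unfolding G_def using innovation_mult[OF f, of "\<lambda>x. cnj (f x)" r] bf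
      by (simp add: bounded_range_cnj)
    then have *: "(LINT x|M. (cmod (\<Sum>n=1..m. G ((T ^^ n) x)))\<^sup>2) \<le> 2 * real L * real m * (K\<^sup>2)\<^sup>2"
      using KG \<open>L \<ge> 1\<close> by (rule innovation_sum_square)
    have "(LINT x|M. cmod (\<Sum>n=1..m. G ((T ^^ n) x)))
        \<le> sqrt (LINT x|M. (cmod (\<Sum>n=1..m. G ((T ^^ n) x)))\<^sup>2)"
      using int1 int2 by (rule expectation_le_sqrt)
    also have "\<dots> \<le> sqrt (2 * real L * real m * (K\<^sup>2)\<^sup>2)"
      using * by simp
    also have "\<dots> = sqrt (2 * real L * real m) * K\<^sup>2"
      using \<open>K \<ge> 0\<close> unfolding real_sqrt_mult[of _ "(K\<^sup>2)\<^sup>2"] by (simp only: real_sqrt_abs abs_of_nonneg zero_le_power2)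
    finally show ?thesis
      using False by (simp add: G_eq)
  qed
qed

text \<open>In the bound for the square of the modulated sum, at most \<open>L\<close> lags cost
  order \<open>N\<close> each and all others order \<open>sqrt N\<close>. Dividing by the square of
  \<open>N\<close> leaves order N^(-1/2), and the root gives N^(-1/4).\<close>

lemma innovation_ww_sup_le:
  assumes f: "f \<in> innovation L" and K: "\<And>x. cmod (f x) \<le> K" and "L \<ge> 1" "N \<ge> 1"
  shows "Lp_norm M 2 (ww_sup T N f) \<le> sqrt (7 * real L) * K * real N powr (-1/4)"
proof -
  have [measurable]: "f \<in> borel_measurable M" "f \<in> borel_measurable B" and bf: "bounded (range f)"
    using innovationD[OF f] by auto
  have "K \<ge> 0"
    using K norm_ge_zero order_trans by blast
  define C where "C r x = cmod (\<Sum>n=1..N-r. f ((T ^^ n) x) * cnj (f ((T ^^ (n + r)) x)))" for r x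
  \<comment> \<open>An integrable majorant of the squared supremum that does not contain
    \<open>t\<close>; only its integral has to be estimated.\<close>
  define W where "W x = (1 / (real N)\<^sup>2) * (real N * K\<^sup>2 + 2 * (\<Sum>r=1..N. C r x))" for x
  have C_int: "integrable M (C r)" for r
    unfolding C_def
    by (intro integrable_norm Bochner_Integration.integrable_sum integrable_bounded_range)
       (auto intro!: bounded_range_mult bounded_range_cnj bounded_range_compose[where f=f] bf)
  have "(cmod (1 / of_nat N * (\<Sum>n=1..N. exp (2 * of_real pi * \<i> * of_nat n * of_real t) * f ((T ^^ n) x))))\<^sup>2 \<le> W x"
    for x t
  proof -
    have "(cmod (\<Sum>n=1..N. exp (2 * of_real pi * \<i> * of_nat n * of_real t) * f ((T ^^ n) x)))\<^sup>2
        \<le> (\<Sum>n=1..N. (cmod (f ((T ^^ n) x)))\<^sup>2) + 2 * (\<Sum>r=1..N. C r x)"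
      unfolding C_def by (rule modulated_sum_square_le)
    also have "\<dots> \<le> (\<Sum>n=1..N. K\<^sup>2) + 2 * (\<Sum>r=1..N. C r x)"
      by (intro add_mono sum_mono power_mono K order_refl) auto
    finally show ?thesis
      by (simp add: W_def norm_mult norm_divide power_mult_distrib power_divide divide_right_mono)
  qed
  then have "cmod (1 / of_nat N * (\<Sum>n=1..N. exp (2 * of_real pi * \<i> * of_nat n * of_real t) * f ((T ^^ n) x))) \<le> sqrt (W x)"
    for x t by (rule real_le_rsqrt)
  note bd = ww_sup_bounds[OF this]
  have W: "(norm (ww_sup T N f x))\<^sup>2 \<le> W x" for x
  proof -
    have "(ww_sup T N f x)\<^sup>2 \<le> (sqrt (W x))\<^sup>2"
      using bd by (intro power_mono)
    moreover have "W x \<ge> 0"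
      unfolding W_def C_def by (auto intro!: divide_nonneg_nonneg add_nonneg_nonneg sum_nonneg)
    ultimately show ?thesis
      by simp
  qed
  have W_int: "integrable M W"
    unfolding W_def by (intro integrable_mult_right Bochner_Integration.integrable_add Bochner_Integration.integrable_sum C_int) auto
  have "(LINT x|M. C r x) \<le> (if r < L then real N * K\<^sup>2 else sqrt (2 * real L * real N) * K\<^sup>2)" for r
  proof -
    have "(LINT x|M. C r x) \<le> (if r < L then real (N-r) * K\<^sup>2 else sqrt (2 * real L * real (N-r)) * K\<^sup>2)"
      unfolding C_def using f K \<open>L \<ge> 1\<close> by (rule innovation_correlation)
    also have "\<dots> \<le> (if r < L then real N * K\<^sup>2 else sqrt (2 * real L * real N) * K\<^sup>2)"
      by (auto intro!: mult_right_mono mult_left_mono)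
    finally show ?thesis .
  qed
  \<comment> \<open>Adding the two cases instead of choosing between them lets the sum over
    \<open>r\<close> split.\<close>
  then have C_le: "(LINT x|M. C r x) \<le> (if r < L then real N * K\<^sup>2 else 0) + sqrt (2 * real L * real N) * K\<^sup>2" for r
    by (rule order_trans) auto
  have "(\<Sum>r=1..N. LINT x|M. C r x) \<le> (\<Sum>r=1..N. (if r < L then real N * K\<^sup>2 else 0) + sqrt (2 * real L * real N) * K\<^sup>2)"
    by (intro sum_mono C_le)
  also have "\<dots> = (\<Sum>r=1..N. if r < L then real N * K\<^sup>2 else 0) + real N * (sqrt (2 * real L * real N) * K\<^sup>2)"
    by (simp add: sum.distrib)
  also have "(\<Sum>r=1..N. if r < L then real N * K\<^sup>2 else 0) = (\<Sum>r\<in>{r\<in>{1..N}. r < L}. real N * K\<^sup>2)"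
    by (rule sum.inter_filter[symmetric]) auto
  also have "\<dots> \<le> (\<Sum>r\<in>{1..<L}. real N * K\<^sup>2)"
    by (intro sum_mono2) auto
  also have "\<dots> \<le> real L * (real N * K\<^sup>2)"
    by (auto intro!: mult_right_mono)
  finally have sum_C: "(\<Sum>r=1..N. LINT x|M. C r x) \<le> real L * (real N * K\<^sup>2) + real N * (sqrt (2 * real L * real N) * K\<^sup>2)"
    by simp
  have "(LINT x|M. W x) = (1 / (real N)\<^sup>2) * (real N * K\<^sup>2 + 2 * (\<Sum>r=1..N. LINT x|M. C r x))"
    unfolding W_def integral_mult_right_zero using C_int
    by (subst Bochner_Integration.integral_add)
       (auto simp: prob_space Bochner_Integration.integral_sum intro!: Bochner_Integration.integrable_sum)
  also have "\<dots> \<le> (1 / (real N)\<^sup>2) * (real N * K\<^sup>2 + 2 * (real L * (real N * K\<^sup>2) + real N * (sqrt (2 * real L * real N) * K\<^sup>2)))"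
    using sum_C by (intro mult_left_mono) auto
  also have "\<dots> = K\<^sup>2 * ((1 + 2 * real L) / real N + 2 * sqrt (2 * real L) * (sqrt (real N) / real N))"
    using \<open>N \<ge> 1\<close> by (simp add: field_simps power2_eq_square real_sqrt_mult)
  \<comment> \<open>The constant is 7 = 3 + 4: for \<open>L \<ge> 1\<close>,
    \<open>1 + 2 * L\<close> is at most \<open>3 * L\<close>, and \<open>2 * sqrt (2 * L)\<close> is
    at most \<open>4 * L\<close>.\<close>
  also have "\<dots> \<le> K\<^sup>2 * (7 * real L * real N powr (-1/2))"
  proof (intro mult_left_mono)
    have N: "sqrt (real N) / real N = real N powr (-1/2)"
      using \<open>N \<ge> 1\<close> by (simp add: powr_minus powr_half_sqrt inverse_eq_divide real_div_sqrt field_simps)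
    have "1 / real N \<le> real N powr (-1/2)"
      using \<open>N \<ge> 1\<close> powr_mono[of "-1" "-1/2" "real N"] by (simp add: powr_minus inverse_eq_divide)
    then have "(1 + 2 * real L) * (1 / real N) \<le> (3 * real L) * real N powr (-1/2)"
      using \<open>L \<ge> 1\<close> by (intro mult_mono) auto
    moreover have "sqrt (2 * real L) \<le> 2 * real L"
      using \<open>L \<ge> 1\<close> by (intro real_le_lsqrt) (auto simp: power2_eq_square)
    then have "2 * sqrt (2 * real L) * real N powr (-1/2) \<le> 2 * (2 * real L) * real N powr (-1/2)"
      by (intro mult_mono) auto
    ultimately show "(1 + 2 * real L) / real N + 2 * sqrt (2 * real L) * (sqrt (real N) / real N)
        \<le> 7 * real L * real N powr (-1/2)"
      unfolding N by simp
  qed simp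
  finally have "Lp_norm M 2 (ww_sup T N f) \<le> (K\<^sup>2 * (7 * real L * real N powr (-1/2))) powr (1/2)"
    using Lp_norm_2_le[OF W_int W] by blast
  also have "\<dots> = sqrt (7 * real L) * K * real N powr (-1/4)"
    using \<open>K \<ge> 0\<close> by (simp add: powr_mult powr_powr powr_half_sqrt real_sqrt_mult)
  finally show ?thesis .
qed

end

section \<open>Cube products and Wiener-Wintner functions of every order\<close>

lemma cmod_cnj_pow [simp]: "cmod ((cnj ^^ n) z) = cmod z"
  by (induction n) auto

lemma borel_measurable_cnj_pow [measurable (raw)]:
  "f \<in> borel_measurable M \<Longrightarrow> (\<lambda>x. (cnj ^^ n) (f x)) \<in> borel_measurable M"
  by (induction n) auto

lemma finite_cube: "finite (cube k)"
  unfolding cube_def by (intro finite_PiE) auto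

lemma cube_product_le:
  assumes "\<And>x. cmod (f x) \<le> K"
  shows "cmod (cube_product T k h f x) \<le> K ^ card (cube k)"
proof -
  have "cmod (cube_product T k h f x) \<le> (\<Prod>\<eta>\<in>cube k. K)"
    unfolding cube_product_def prod_norm[symmetric] using assms by (intro prod_mono) auto
  then show ?thesis
    by simp
qed

lemma card_box: "card (box R k) = R ^ k"
  unfolding box_def by (subst card_PiE) auto

lemma finite_box: "finite (box R k)"
  unfolding box_def by (intro finite_PiE) auto

text \<open>One coordinate has at most \<open>L - 1\<close> values left and the other
  \<open>d\<close> have \<open>R\<close>. Relative to the whole box the exceptional slab has density
  at most \<open>L / R\<close>.\<close>

lemma card_box_slab_le:
  assumes "j < Suc d"
  shows "card {h \<in> box R (Suc d). h j < L} \<le> L * R ^ d"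
proof -
  have "{h \<in> box R (Suc d). h j < L} \<subseteq> PiE {..<Suc d} (\<lambda>i. if i = j then {1..<L} else {1..R})"
    by (auto simp: box_def PiE_iff extensional_def)
  then have "card {h \<in> box R (Suc d). h j < L} \<le> card (PiE {..<Suc d} (\<lambda>i. if i = j then {1..<L} else {1..R}))"
    by (intro card_mono finite_PiE) auto
  also have "\<dots> = (\<Prod>i<Suc d. card (if i = j then {1..<L} else {1..R}))"
    by (rule card_PiE) simp
  also have "\<dots> = (L - 1) * (\<Prod>i\<in>{..<Suc d} - {j}. card (if i = j then {1..<L} else {1..R}))"
    using assms by (subst prod.remove[of _ j]) auto
  also have "(\<Prod>i\<in>{..<Suc d} - {j}. card (if i = j then {1..<L} else {1..R})) = (\<Prod>i\<in>{..<Suc d} - {j}. R)"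
    by (intro prod.cong) auto
  also have "\<dots> = R ^ d"
    using assms by simp
  also have "(L - 1) * R ^ d \<le> L * R ^ d"
    by simp
  finally show ?thesis .
qed

context invariant_subalgebra
begin

text \<open>A test function seen through \<open>T ^^ L'\<close> is also one seen through
  \<open>T ^^ L\<close>, after composition with \<open>T ^^ (L' - L)\<close>.\<close>

lemma innovation_mono:
  assumes f: "f \<in> innovation L" and "L \<le> L'"
  shows "f \<in> innovation L'"
proof -
  have "(LINT x|M. f x * g ((T ^^ L') x)) = 0"
    if "g \<in> borel_measurable B" "bounded (range g)" for g
  proof -
    have "(\<lambda>x. g ((T ^^ (L' - L)) x)) \<in> borel_measurable B"
      using that by measurable
    then have "(LINT x|M. f x * g ((T ^^ (L' - L)) ((T ^^ L) x))) = 0"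
      using f that unfolding innovation_def
      by (auto dest!: bspec[of _ _ "\<lambda>x. g ((T ^^ (L' - L)) x)"] intro: bounded_range_compose)
    moreover have "(T ^^ (L' - L)) ((T ^^ L) x) = (T ^^ L') x" for x
      using \<open>L \<le> L'\<close> by (metis comp_apply funpow_add le_add_diff_inverse2)
    ultimately show ?thesis by simp
  qed
  then show ?thesis
    using f by (auto simp: innovation_def)
qed

text \<open>The zero vertex contributes \<open>f\<close> itself, unshifted and unconjugated. Every
  other vertex has a nonzero coordinate, so its shift is at least some \<open>h j \<ge> L\<close>,
  and \<open>innovation_mult_prod\<close> absorbs its factor.\<close>

lemma cube_product_innovation:
  assumes f: "f \<in> innovation L" and h: "\<And>j. j < k \<Longrightarrow> L \<le> h j"
  shows "cube_product T k h f \<in> innovation L"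
proof -
  \<comment> \<open>The zero vertex, extensional on \<open>{..<k}\<close> as \<open>cube\<close>
    demands.\<close>
  define z where "z = (\<lambda>j\<in>{..<k}. 0::nat)"
  have z: "z \<in> cube k" "(\<Sum>j<k. z j) = 0" "(\<Sum>j<k. h j * z j) = 0"
    by (auto simp: z_def cube_def)
  have ge: "L \<le> (\<Sum>j<k. h j * \<eta> j)" if \<eta>: "\<eta> \<in> cube k - {z}" for \<eta>
  proof -
    obtain j where "j < k" "\<eta> j \<noteq> 0"
    proof (rule ccontr)
      assume "\<not> thesis"
      then have "\<eta> j = z j" for j
        using that \<eta> by (cases "j < k") (auto simp: z_def cube_def PiE_iff extensional_def)
      then show False
        using \<eta> by auto
    qed
    then have "h j \<le> h j * \<eta> j"
      by simp
    also have "\<dots> \<le> (\<Sum>j<k. h j * \<eta> j)"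
      using \<open>j < k\<close> by (intro member_le_sum) auto
    finally show ?thesis
      using h[OF \<open>j < k\<close>] by simp
  qed
  obtain K where "\<And>x. cmod (f x) \<le> K" "K \<ge> 0"
    using innovationD(2)[OF f] by (auto simp: bounded_range_iff)
  then have "bounded (range (\<lambda>y. (cnj ^^ n) (f y)))" for n
    by (auto simp: bounded_range_iff)
  then have "(\<lambda>x. f x * (\<Prod>\<eta>\<in>cube k - {z}. (cnj ^^ (\<Sum>j<k. \<eta> j)) (f ((T ^^ (\<Sum>j<k. h j * \<eta> j)) x)))) \<in> innovation L"
    using ge innovationD(1)[OF f] finite_cube
    by (intro innovation_mult_prod[OF f, where u="\<lambda>\<eta> y. (cnj ^^ (\<Sum>j<k. \<eta> j)) (f y)"]) auto
  then show ?thesis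
    unfolding cube_product_def using z(2,3) by (subst prod.remove[OF finite_cube z(1)]) simp
qed

lemma innovation_Linf:
  assumes "f \<in> innovation L"
  shows "f \<in> Linf M"
  using innovationD[OF assms] by (auto simp: Linf_def bounded_range_iff)

text \<open>The power \<open>2/3\<close> in the definition turns N^(-1/4) into N^(-1/6). The
  \<open>h\<close> with a coordinate below \<open>L\<close> have density of order 1/R, that is
  N^(-1/2), which is smaller. For order 1 the stronger decay is simply weakened to the same
  exponent.\<close>

lemma innovation_ww_function:
  assumes "f \<in> innovation L0" "J \<ge> 1"
  shows "ww_function M T J (1/6) 2 f"
proof -
  define L where "L = max 1 L0"
  have f: "f \<in> innovation L"
    using assms(1) by (rule innovation_mono) (simp add: L_def)
  have "L \<ge> 1"
    by (simp add: L_def)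
  obtain K where K: "\<And>x. cmod (f x) \<le> K" "K \<ge> 0"
    using innovationD(2)[OF f] by (auto simp: bounded_range_iff)
  show ?thesis
  proof (cases "J = 1")
    case True
    \<comment> \<open>The summand 1 keeps the constant positive even when
      \<open>K = 0\<close>.\<close>
    have "Lp_norm M 2 (ww_sup T N f) \<le> (sqrt (7 * real L) * K + 1) * real N powr (-(1/6))" if "N \<ge> 1" for N
    proof -
      have "Lp_norm M 2 (ww_sup T N f) \<le> sqrt (7 * real L) * K * real N powr (-1/4)"
        using f K(1) \<open>L \<ge> 1\<close> that by (rule innovation_ww_sup_le)
      also have "\<dots> \<le> (sqrt (7 * real L) * K + 1) * real N powr (-(1/6))"
        using that K by (intro mult_mono powr_mono) auto
      finally show ?thesis .
    qed
    moreover have "sqrt (7 * real L) * K + 1 > 0"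
      using K by (intro add_nonneg_pos) auto
    ultimately have "ww_function_1 M T (1/6) 2 f"
      using innovation_Linf[OF f] unfolding ww_function_1_def by blast
    with True show ?thesis
      by (simp add: ww_function_def)
  next
    case False
    define d where "d = J - 2"
    with False \<open>J \<ge> 1\<close> have J: "J - 1 = Suc d" "J \<ge> 2"
      by auto
    define KF where "KF = K ^ card (cube (Suc d))"
    define A where "A = (sqrt (7 * real L) * KF) powr (2/3)"
    define D where "D = KF powr (2/3)"
    define c where "c = real (Suc d) * D * real L"
    define v where "v N h = Lp_norm M 2 (ww_sup T N (cube_product T (Suc d) h f)) powr (2/3)" for N h
    have "KF \<ge> 0"
      using K by (simp add: KF_def)
    have "A \<ge> 0" "D \<ge> 0" "c \<ge> 0"
      by (auto simp: A_def D_def c_def)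
    have KF: "cmod (cube_product T (Suc d) h f x) \<le> KF" for h x
      unfolding KF_def by (intro cube_product_le K)
    \<comment> \<open>The sum over \<open>j\<close> is a union bound: it vanishes for good
      \<open>h\<close> and is at least \<open>D\<close> as soon as one coordinate is below
      \<open>L\<close>.\<close>
    have v_le: "v N h \<le> A * real N powr (-1/6) + (\<Sum>j<Suc d. if h j < L then D else 0)" if "N \<ge> 1" for N h
    proof (cases "\<forall>j<Suc d. L \<le> h j")
      case True
      then have "cube_product T (Suc d) h f \<in> innovation L"
        by (intro cube_product_innovation[OF f]) auto
      then have "Lp_norm M 2 (ww_sup T N (cube_product T (Suc d) h f)) \<le> sqrt (7 * real L) * KF * real N powr (-1/4)"
        using KF \<open>L \<ge> 1\<close> that by (rule innovation_ww_sup_le)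
      then have "v N h \<le> (sqrt (7 * real L) * KF * real N powr (-1/4)) powr (2/3)"
        unfolding v_def by (intro powr_mono2 Lp_norm_nonneg) auto
      also have "\<dots> = A * real N powr (-1/6)"
        using \<open>KF \<ge> 0\<close> by (simp add: A_def powr_mult powr_powr)
      moreover have "(\<Sum>j<Suc d. if h j < L then D else 0) \<ge> 0"
        using \<open>D \<ge> 0\<close> by (intro sum_nonneg) auto
      ultimately show ?thesis
        by simp
    next
      case False
      then obtain j where j: "j < Suc d" "h j < L"
        by (auto simp: not_le)
      have "v N h \<le> D"
        unfolding v_def D_def by (intro powr_mono2 Lp_norm_nonneg Lp_norm_ww_sup_le_bound KF that) auto
      also have "D = (if h j < L then D else 0)"
        using j by simp
      also have "\<dots> \<le> (\<Sum>j<Suc d. if h j < L then D else 0)"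
        using j \<open>D \<ge> 0\<close> by (intro member_le_sum) auto
      finally show ?thesis
        using \<open>A \<ge> 0\<close> by (simp add: add_increasing)
    qed
    \<comment> \<open>Applied with \<open>r = R\<close> and \<open>p = R ^ d\<close>.\<close>
    have average: "1 / (r * p) * (r * p * a + c * p) = a + c * (1 / r)" if "r > 0" "p > 0" for a r p :: real
      using that by (simp add: field_simps)
    have "(1 / real R ^ Suc d) * (\<Sum>h\<in>box R (Suc d). v N h) \<le> (A + 2 * c + 1) / real N powr (1/6)"
      if "N \<ge> 1" and R: "R = nat \<lfloor>sqrt (real N)\<rfloor>" for N R
    proof -
      have "R \<ge> 1" and "sqrt (real N) \<le> real R + 1"
        unfolding R using that by (auto simp: le_nat_iff le_floor_iff)
      \<comment> \<open>The floor loses at most 1, and \<open>R \<ge> 1\<close>; hence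
        \<open>1 / R\<close> is at most twice N^(-1/2).\<close>
      then have "sqrt (real N) \<le> 2 * real R"
        by linarith
      then have "1 / real R \<le> 2 * real N powr (-1/2)"
        using \<open>R \<ge> 1\<close> \<open>N \<ge> 1\<close> by (simp add: powr_minus powr_half_sqrt field_simps)
      also have "\<dots> \<le> 2 * real N powr (-1/6)"
        using \<open>N \<ge> 1\<close> by (intro mult_left_mono powr_mono) auto
      finally have R1: "1 / real R \<le> 2 * real N powr (-1/6)" .
      have "(\<Sum>h\<in>box R (Suc d). v N h) \<le> (\<Sum>h\<in>box R (Suc d). A * real N powr (-1/6) + (\<Sum>j<Suc d. if h j < L then D else 0))"
        by (intro sum_mono v_le that)
      also have "\<dots> = real R ^ Suc d * (A * real N powr (-1/6)) + (\<Sum>j<Suc d. \<Sum>h\<in>box R (Suc d). if h j < L then D else 0)"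
        unfolding sum.distrib by (subst sum.swap) (simp add: card_box)
      also have "(\<Sum>j<Suc d. \<Sum>h\<in>box R (Suc d). if h j < L then D else 0)
          = (\<Sum>j<Suc d. real (card {h\<in>box R (Suc d). h j < L}) * D)"
        by (intro sum.cong refl) (subst sum.inter_filter[symmetric, OF finite_box], simp)
      also have "\<dots> \<le> (\<Sum>j<Suc d. real (L * R ^ d) * D)"
        using \<open>D \<ge> 0\<close> by (intro sum_mono mult_right_mono of_nat_mono card_box_slab_le) auto
      also have "\<dots> = c * real R ^ d"
        by (simp add: c_def)
      finally have "(1 / real R ^ Suc d) * (\<Sum>h\<in>box R (Suc d). v N h)
          \<le> (1 / real R ^ Suc d) * (real R ^ Suc d * (A * real N powr (-1/6)) + c * real R ^ d)"
        by (intro mult_left_mono) auto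
      also have "\<dots> = A * real N powr (-1/6) + c * (1 / real R)"
        using \<open>R \<ge> 1\<close> unfolding power_Suc by (intro average) auto
      also have "\<dots> \<le> A * real N powr (-1/6) + c * (2 * real N powr (-1/6))"
        using R1 \<open>c \<ge> 0\<close> by (intro add_left_mono mult_left_mono) auto
      also have "\<dots> \<le> (A + 2 * c + 1) * real N powr (-1/6)"
        by (simp add: distrib_right)
      also have "\<dots> = (A + 2 * c + 1) / real N powr (1/6)"
        by (simp add: powr_minus_divide)
      finally show ?thesis .
    qed
    note ge2 = this
    have "A + 2 * c + 1 > 0"
      using \<open>A \<ge> 0\<close> \<open>c \<ge> 0\<close> by (intro add_nonneg_pos) auto
    then have "ww_function_ge2 M T J (1/6) 2 f"
      unfolding ww_function_ge2_def J(1) Let_def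
      using innovation_Linf[OF f] ge2[unfolded v_def] by (intro conjI exI[of _ "A + 2 * c + 1"] allI impI) simp_all
    with J show ?thesis
      by (simp add: ww_function_def)
  qed
qed

end

section \<open>Density in \<open>L\<^sup>2\<close>\<close>

text \<open>A triangle inequality for squares with constant 2. It takes the place of Minkowski's
  inequality, which is why errors below are split into quarters.\<close>

lemma norm_add_square_le: "(norm (a + b))\<^sup>2 \<le> 2 * (norm a)\<^sup>2 + 2 * (norm b)\<^sup>2"
proof -
  have "(norm (a + b))\<^sup>2 \<le> (norm a + norm b)\<^sup>2"
    by (intro power_mono norm_triangle_ineq norm_ge_zero)
  also have "\<dots> \<le> 2 * (norm a)\<^sup>2 + 2 * (norm b)\<^sup>2"
    using zero_le_power2[of "norm a - norm b"] by (simp add: power2_eq_square algebra_simps)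
  finally show ?thesis .
qed

lemma L2_add:
  assumes "f \<in> L2 M" "g \<in> L2 M"
  shows "(\<lambda>x. f x + g x) \<in> L2 M"
proof -
  have [measurable]: "f \<in> borel_measurable M" "g \<in> borel_measurable M"
    using assms by (auto simp: L2_def)
  have "integrable M (\<lambda>x. 2 * (cmod (f x))\<^sup>2 + 2 * (cmod (g x))\<^sup>2)"
    using assms by (auto simp: L2_def)
  then have "integrable M (\<lambda>x. (cmod (f x + g x))\<^sup>2)"
    by (rule Bochner_Integration.integrable_bound) (auto intro: norm_add_square_le)
  then show ?thesis
    by (simp add: L2_def)
qed

lemma L2_mult_const:
  assumes "f \<in> L2 M"
  shows "(\<lambda>x. c * f x) \<in> L2 M"
  using assms by (auto simp: L2_def norm_mult power_mult_distrib)

lemma L2_diff: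
  assumes "f \<in> L2 M" "g \<in> L2 M"
  shows "(\<lambda>x. f x - g x) \<in> L2 M"
  using L2_add[OF assms(1) L2_mult_const[OF assms(2), of "-1"]] by simp

lemma integral_norm_add_square_le:
  assumes "f \<in> L2 M" "g \<in> L2 M"
  shows "(LINT x|M. (cmod (f x + g x))\<^sup>2) \<le> 2 * (LINT x|M. (cmod (f x))\<^sup>2) + 2 * (LINT x|M. (cmod (g x))\<^sup>2)"
proof -
  have "(LINT x|M. (cmod (f x + g x))\<^sup>2) \<le> (LINT x|M. 2 * (cmod (f x))\<^sup>2 + 2 * (cmod (g x))\<^sup>2)"
    using assms L2_add[OF assms] by (intro integral_mono norm_add_square_le) (auto simp: L2_def)
  also have "\<dots> = 2 * (LINT x|M. (cmod (f x))\<^sup>2) + 2 * (LINT x|M. (cmod (g x))\<^sup>2)"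
    using assms by (subst Bochner_Integration.integral_add) (auto simp: L2_def)
  finally show ?thesis .
qed

text \<open>Distance is measured by the integral of the square, without the root in
  \<open>Lp_norm\<close>. The elements are functions, so the closure contains every measurable
  modification of its members on a null set.\<close>

definition L2_closure :: "'a measure \<Rightarrow> ('a \<Rightarrow> complex) set \<Rightarrow> ('a \<Rightarrow> complex) set" where
  "L2_closure M V = {v \<in> L2 M. \<forall>e>0. \<exists>f\<in>V. (LINT x|M. (cmod (v x - f x))\<^sup>2) < e}"

lemma L2_closure_add:
  assumes V: "V \<subseteq> L2 M" "\<And>f g. f \<in> V \<Longrightarrow> g \<in> V \<Longrightarrow> (\<lambda>x. f x + g x) \<in> V"
    and u: "u \<in> L2_closure M V" and v: "v \<in> L2_closure M V"
  shows "(\<lambda>x. u x + v x) \<in> L2_closure M V"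
proof -
  have uv: "u \<in> L2 M" "v \<in> L2 M"
    using u v by (auto simp: L2_closure_def)
  have "\<exists>h\<in>V. (LINT x|M. (cmod (u x + v x - h x))\<^sup>2) < e" if "e > 0" for e
  proof -
    have "e / 4 > 0"
      using that by simp
    then obtain f g where fg: "f \<in> V" "(LINT x|M. (cmod (u x - f x))\<^sup>2) < e / 4"
      "g \<in> V" "(LINT x|M. (cmod (v x - g x))\<^sup>2) < e / 4"
      using u v unfolding L2_closure_def by blast
    have "(LINT x|M. (cmod (u x + v x - (f x + g x)))\<^sup>2) = (LINT x|M. (cmod ((u x - f x) + (v x - g x)))\<^sup>2)"
      by (simp add: algebra_simps)
    also have "\<dots> \<le> 2 * (LINT x|M. (cmod (u x - f x))\<^sup>2) + 2 * (LINT x|M. (cmod (v x - g x))\<^sup>2)"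
      using uv fg V(1) by (intro integral_norm_add_square_le L2_diff) auto
    also have "\<dots> < e"
      using fg by simp
    finally show ?thesis
      using V(2)[OF fg(1,3)] by (rule bexI)
  qed
  then show ?thesis
    using uv by (auto simp: L2_closure_def L2_add)
qed

lemma L2_closure_mult_const:
  assumes V: "\<And>f c. f \<in> V \<Longrightarrow> (\<lambda>x. c * f x) \<in> V"
    and u: "u \<in> L2_closure M V"
  shows "(\<lambda>x. c * u x) \<in> L2_closure M V"
proof -
  have "\<exists>h\<in>V. (LINT x|M. (cmod (c * u x - h x))\<^sup>2) < e" if "e > 0" for e
  proof -
    \<comment> \<open>The added 1 covers the case \<open>c = 0\<close> in the division.\<close>
    have pos: "(cmod c)\<^sup>2 + 1 > 0"
      by (intro add_nonneg_pos) auto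
    then have "e / ((cmod c)\<^sup>2 + 1) > 0"
      using that by simp
    then obtain f where f: "f \<in> V" "(LINT x|M. (cmod (u x - f x))\<^sup>2) < e / ((cmod c)\<^sup>2 + 1)"
      using u unfolding L2_closure_def by blast
    have "(LINT x|M. (cmod (c * u x - c * f x))\<^sup>2) = (cmod c)\<^sup>2 * (LINT x|M. (cmod (u x - f x))\<^sup>2)"
      by (simp add: right_diff_distrib[symmetric] norm_mult power_mult_distrib)
    also have "\<dots> \<le> ((cmod c)\<^sup>2 + 1) * (LINT x|M. (cmod (u x - f x))\<^sup>2)"
      by (intro mult_right_mono) auto
    also have "\<dots> < e"
      using f(2) pos by (simp add: field_simps)
    finally show ?thesis
      using V[OF f(1)] by (rule bexI)
  qed
  then show ?thesis
    using u by (auto simp: L2_closure_def L2_mult_const)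
qed

lemma L2_closure_limit:
  assumes V: "V \<subseteq> L2 M" and v: "v \<in> L2 M"
    and lim: "\<And>e. e > 0 \<Longrightarrow> \<exists>u\<in>L2_closure M V. (LINT x|M. (cmod (v x - u x))\<^sup>2) < e"
  shows "v \<in> L2_closure M V"
proof -
  have "\<exists>h\<in>V. (LINT x|M. (cmod (v x - h x))\<^sup>2) < e" if "e > 0" for e
  proof -
    have e: "e / 4 > 0"
      using that by simp
    then obtain u where u: "u \<in> L2_closure M V" "(LINT x|M. (cmod (v x - u x))\<^sup>2) < e / 4"
      using lim by blast
    then obtain f where f: "f \<in> V" "(LINT x|M. (cmod (u x - f x))\<^sup>2) < e / 4"
      using e unfolding L2_closure_def by blast
    have "(LINT x|M. (cmod (v x - f x))\<^sup>2) = (LINT x|M. (cmod ((v x - u x) + (u x - f x)))\<^sup>2)"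
      by simp
    also have "\<dots> \<le> 2 * (LINT x|M. (cmod (v x - u x))\<^sup>2) + 2 * (LINT x|M. (cmod (u x - f x))\<^sup>2)"
      using v u f V by (intro integral_norm_add_square_le L2_diff) (auto simp: L2_closure_def)
    also have "\<dots> < e"
      using u f by simp
    finally show ?thesis
      using f(1) by (rule bexI)
  qed
  then show ?thesis
    using v by (auto simp: L2_closure_def)
qed

text \<open>Dominated convergence: both \<open>u n\<close> and \<open>v\<close> are bounded by
  \<open>w\<close>, so the squared difference is at most \<open>4\<close> times the square of
  \<open>w\<close>. With a constant sequence \<open>u\<close> it also permits changes on null
  sets.\<close>

lemma L2_closure_dominated_limit:
  fixes u :: "nat \<Rightarrow> 'a \<Rightarrow> complex"
  assumes V: "V \<subseteq> L2 M" and u: "\<And>n. u n \<in> L2_closure M V"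
    and [measurable]: "v \<in> borel_measurable M"
    and w: "integrable M (\<lambda>x. (w x)\<^sup>2)"
    and lim: "AE x in M. (\<lambda>n. u n x) \<longlonglongrightarrow> v x"
    and bd: "\<And>n. AE x in M. cmod (u n x) \<le> w x" "AE x in M. cmod (v x) \<le> w x"
  shows "v \<in> L2_closure M V"
proof (rule L2_closure_limit[OF V])
  have uL2: "u n \<in> L2 M" for n
    using u[of n] by (auto simp: L2_closure_def)
  then have [measurable]: "u n \<in> borel_measurable M" for n
    by (auto simp: L2_def)
  have "integrable M (\<lambda>x. (cmod (v x))\<^sup>2)"
    using bd(2) by (intro Bochner_Integration.integrable_bound[OF w]) (auto intro!: power_mono elim!: eventually_mono)
  then show v: "v \<in> L2 M"
    by (simp add: L2_def)
  have "(\<lambda>n. LINT x|M. (cmod (v x - u n x))\<^sup>2) \<longlonglongrightarrow> (LINT x|M. 0)"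
  proof (rule integral_dominated_convergence)
    show "integrable M (\<lambda>x. 4 * (w x)\<^sup>2)"
      using w by simp
    show "AE x in M. (\<lambda>n. (cmod (v x - u n x))\<^sup>2) \<longlonglongrightarrow> 0"
      using lim
    proof eventually_elim
      case (elim x)
      have "(\<lambda>n. (cmod (v x - u n x))\<^sup>2) \<longlonglongrightarrow> (cmod (v x - v x))\<^sup>2"
        by (intro tendsto_intros elim)
      then show ?case by simp
    qed
    show "AE x in M. norm ((cmod (v x - u n x))\<^sup>2) \<le> 4 * (w x)\<^sup>2" for n
      using bd(1)[of n] bd(2)
    proof eventually_elim
      case (elim x)
      have "(cmod (v x - u n x))\<^sup>2 \<le> (2 * w x)\<^sup>2"
        using elim norm_triangle_ineq4[of "v x" "u n x"] by (intro power_mono) auto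
      then show ?case
        by (simp add: power2_eq_square)
    qed
  qed measurable
  then have "(\<lambda>n. LINT x|M. (cmod (v x - u n x))\<^sup>2) \<longlonglongrightarrow> 0"
    by simp
  then show "\<exists>u\<in>L2_closure M V. (LINT x|M. (cmod (v x - u x))\<^sup>2) < e" if "e > 0" for e
    using eventually_happens'[OF sequentially_bot order_tendstoD(2)[OF _ that]] u by blast
qed

text \<open>A Dynkin class argument: the sets whose indicators lie in the closure contain the
  pi-system \<open>G\<close> and are closed under complements and disjoint unions. Null sets, simple
  functions and dominated limits then lead to all of L^2.\<close>

lemma (in finite_measure) L2_closure_eqI:
  assumes V: "V \<subseteq> L2 M" "V \<noteq> {}"
    and add: "\<And>f g. f \<in> V \<Longrightarrow> g \<in> V \<Longrightarrow> (\<lambda>x. f x + g x) \<in> V"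
    and mult: "\<And>f c. f \<in> V \<Longrightarrow> (\<lambda>x. c * f x) \<in> V"
    and G: "Int_stable G" "G \<subseteq> sets M"
    and gen: "\<And>B. B \<in> sets M \<Longrightarrow> \<exists>C\<in>sigma_sets (space M) G. (B - C) \<union> (C - B) \<in> null_sets M"
    and ind: "\<And>D. D \<in> insert (space M) G \<Longrightarrow> indicator D \<in> L2_closure M V"
  shows "L2_closure M V = L2 M"
proof
  note cl_add = L2_closure_add[OF V(1) add]
  note cl_mult = L2_closure_mult_const[of V, OF mult]
  note cl_lim = L2_closure_dominated_limit[OF V(1)]
  obtain f where "f \<in> V"
    using V(2) by blast
  then have "(\<lambda>_. 0) \<in> V"
    using mult[of f 0] by simp
  then have zero: "(\<lambda>_. 0) \<in> L2_closure M V"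
    using V(1) by (auto simp: L2_closure_def intro!: bexI[of _ "\<lambda>_. 0"])
  have cl_sum: "(\<lambda>x. \<Sum>i\<in>I. u i x) \<in> L2_closure M V" if "finite I" "\<And>i. i \<in> I \<Longrightarrow> u i \<in> L2_closure M V"
    for I :: "'i set" and u
    using that by (induction I) (auto simp: zero intro: cl_add)
  have indicator_empty_eq: "(indicator {} :: 'a \<Rightarrow> complex) = (\<lambda>_. 0)"
    by (simp add: fun_eq_iff)
  have gen_sets: "C \<in> sets M" if "C \<in> sigma_sets (space M) G" for C
    using sets.sigma_sets_subset[OF G(2)] that by blast
  have sig: "indicator C \<in> L2_closure M V" if "C \<in> sigma_sets (space M) G" for C
    using G(1) order_trans[OF G(2) sets.space_closed] that
  proof (induction rule: sigma_sets_induct_disjoint)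
    show "indicator {} \<in> L2_closure M V"
      using zero by (simp add: indicator_empty_eq)
    show "indicator A \<in> L2_closure M V" if "A \<in> G" for A
      using that ind by blast
  next
    fix A
    assume A: "A \<in> sigma_sets (space M) G" "(indicator A :: 'a \<Rightarrow> complex) \<in> L2_closure M V"
    have "A \<subseteq> space M"
      using gen_sets[OF A(1)] by (rule sets.sets_into_space)
    \<comment> \<open>Complements require the constant 1, which is why \<open>space M\<close> is
      adjoined to \<open>G\<close> in the last hypothesis.\<close>
    then have "(indicator (space M - A) :: 'a \<Rightarrow> complex) = (\<lambda>x. indicator (space M) x + (-1) * indicator A x)"
      by (auto simp: fun_eq_iff indicator_def)
    then show "(indicator (space M - A) :: 'a \<Rightarrow> complex) \<in> L2_closure M V"
      by (simp only:) (intro cl_add cl_mult A ind insertI1)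
  next
    fix A :: "nat \<Rightarrow> 'a set"
    assume A: "disjoint_family A" "range A \<subseteq> sigma_sets (space M) G"
      and IH: "\<And>i. (indicator (A i) :: 'a \<Rightarrow> complex) \<in> L2_closure M V"
    have [measurable]: "A i \<in> sets M" for i
      using A(2) gen_sets by blast
    show "(indicator (\<Union>i. A i) :: 'a \<Rightarrow> complex) \<in> L2_closure M V"
    proof (rule cl_lim[where w="\<lambda>_. 1" and u="\<lambda>n x. \<Sum>i<n. indicator (A i) x"])
      have eq: "(\<Sum>i<n. indicator (A i) x) = (indicator (\<Union>i<n. A i) x :: complex)" for n x
        by (rule indicator_UN_disjoint[symmetric]) (use A(1) in \<open>auto simp: disjoint_family_on_def\<close>)
      show "(\<lambda>x. \<Sum>i<n. indicator (A i) x) \<in> L2_closure M V" for n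
        by (intro cl_sum IH) auto
      show "AE x in M. (\<lambda>n. \<Sum>i<n. indicator (A i) x) \<longlonglongrightarrow> (indicator (\<Union>i. A i) x :: complex)"
        unfolding eq by (intro AE_I2 LIMSEQ_indicator_UN)
      show "AE x in M. cmod (\<Sum>i<n. indicator (A i) x) \<le> 1" for n
        unfolding eq by (auto simp: indicator_def)
    qed (auto simp: indicator_def)
  qed
  have meas: "indicator B \<in> L2_closure M V" if "B \<in> sets M" for B
  proof -
    obtain C where C: "C \<in> sigma_sets (space M) G" "(B - C) \<union> (C - B) \<in> null_sets M"
      using gen \<open>B \<in> sets M\<close> by blast
    have "AE x in M. x \<notin> (B - C) \<union> (C - B)"
      using C(2) by (rule AE_not_in)
    then have ae: "AE x in M. indicator C x = (indicator B x :: complex)"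
      by eventually_elim (auto simp: indicator_def)
    \<comment> \<open>A constant sequence: the limit rule replaces \<open>C\<close> by
      \<open>B\<close> off a null set.\<close>
    show ?thesis
      by (rule cl_lim[where w="\<lambda>_. 1" and u="\<lambda>_. indicator C"]) (use sig[OF C(1)] ae \<open>B \<in> sets M\<close> in \<open>auto simp: indicator_def elim!: eventually_mono\<close>)
  qed
  show "L2 M \<subseteq> L2_closure M V"
  proof
    fix v
    assume v: "v \<in> L2 M"
    then have [measurable]: "v \<in> borel_measurable M"
      by (auto simp: L2_def)
    obtain s where "(\<forall>i. simple_function M (s i)) \<and> (\<forall>x\<in>space M. (\<lambda>i. s i x) \<longlonglongrightarrow> v x) \<and>
        (\<forall>i. \<forall>x\<in>space M. dist (s i x) 0 \<le> 2 * dist (v x) 0)"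
      using borel_measurable_implies_sequence_metric[OF \<open>v \<in> borel_measurable M\<close>] by (rule exE)
    then have s: "simple_function M (s i)" "x \<in> space M \<Longrightarrow> (\<lambda>i. s i x) \<longlonglongrightarrow> v x"
      "x \<in> space M \<Longrightarrow> cmod (s i x) \<le> 2 * cmod (v x)" for i x
      by simp_all
    \<comment> \<open>Again a constant sequence, since \<open>s i\<close> agrees with its
      representation by indicators only on \<open>space M\<close>.\<close>
    have simple: "s i \<in> L2_closure M V" for i
    proof (rule cl_lim[where w="\<lambda>x. 2 * cmod (v x)" and u="\<lambda>_ x. \<Sum>y\<in>s i ` space M. y * indicator (s i -` {y} \<inter> space M) x"])
      show "(\<lambda>x. \<Sum>y\<in>s i ` space M. y * indicator (s i -` {y} \<inter> space M) x) \<in> L2_closure M V"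
        by (intro cl_sum cl_mult meas simple_functionD[OF s(1)[of i]])
      have eq: "s i x = (\<Sum>y\<in>s i ` space M. y * indicator (s i -` {y} \<inter> space M) x)" if "x \<in> space M" for x
      proof -
        have "indicat_real A x *\<^sub>R y = y * indicator A x" for A and y :: complex
          by (simp split: split_indicator)
        then show ?thesis
          by (subst simple_function_indicator_representation_banach[OF s(1)[of i] that]) (simp only:)
      qed
      show "AE x in M. (\<lambda>_. \<Sum>y\<in>s i ` space M. y * indicator (s i -` {y} \<inter> space M) x) \<longlonglongrightarrow> s i x"
        by (intro AE_I2) (simp add: eq[symmetric])
      show "AE x in M. cmod (\<Sum>y\<in>s i ` space M. y * indicator (s i -` {y} \<inter> space M) x) \<le> 2 * cmod (v x)"
        using s(3) by (intro AE_I2) (simp add: eq[symmetric])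
      show "AE x in M. cmod (s i x) \<le> 2 * cmod (v x)"
        using s(3) by (intro AE_I2) simp
      show "integrable M (\<lambda>x. (2 * cmod (v x))\<^sup>2)"
        using v by (simp add: L2_def power_mult_distrib)
      show "s i \<in> borel_measurable M"
        using s(1) by (rule borel_measurable_simple_function)
    qed
    show "v \<in> L2_closure M V"
      by (rule cl_lim[where w="\<lambda>x. 2 * cmod (v x)" and u=s]) (use v s simple in \<open>auto simp: L2_def power_mult_distrib\<close>)
  qed
qed (auto simp: L2_closure_def)

section \<open>Reverse martingales\<close>

context prob_space
begin

text \<open>Clamping makes the conditional expectation bounded everywhere, as \<open>innovation\<close> demands;
  \<open>real_cond_exp\<close> itself is bounded only almost everywhere.\<close>
lemma bounded_cond_exp_exists:
  fixes w :: "'a \<Rightarrow> real"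
  assumes F: "subalgebra M F" and [measurable]: "w \<in> borel_measurable M" and K: "\<And>x. \<bar>w x\<bar> \<le> K"
  shows "\<exists>u\<in>borel_measurable F. (\<forall>x. \<bar>u x\<bar> \<le> K) \<and>
    (\<forall>g\<in>borel_measurable F. bounded (range g) \<longrightarrow> (LINT x|M. g x * u x) = (LINT x|M. g x * w x))"
proof -
  interpret finite_measure_subalgebra M F
    using F by unfold_locales
  have "K \<ge> 0"
    using K[of undefined] by linarith
  have w: "integrable M w"
    using K by (intro integrable_const_bound[of _ K]) auto
  define u where "u x = max (- K) (min K (real_cond_exp M F w x))" for x
  have "AE x in M. real_cond_exp M F w x \<ge> - K"
    using K by (intro real_cond_exp_ge_c w AE_I2) (simp add: abs_le_iff minus_le_iff)
  moreover have "AE x in M. real_cond_exp M F w x \<le> K"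
    using K by (intro real_cond_exp_le_c w AE_I2) (simp add: abs_le_iff)
  ultimately have ae: "AE x in M. u x = real_cond_exp M F w x"
    by eventually_elim (simp add: u_def)
  have u_F [measurable]: "u \<in> borel_measurable F"
    unfolding u_def by measurable
  then have [measurable]: "u \<in> borel_measurable M"
    by (rule measurable_from_subalg[OF F])
  have "(LINT x|M. g x * u x) = (LINT x|M. g x * w x)"
    if [measurable]: "g \<in> borel_measurable F" and bg: "bounded (range g)" for g
  proof -
    have gM [measurable]: "g \<in> borel_measurable M"
      using that(1) by (rule measurable_from_subalg[OF F])
    have "bounded (range w)"
      using K by (auto simp: bounded_iff)
    with bg have "integrable M (\<lambda>x. g x * w x)"
      by (intro integrable_bounded_range bounded_range_mult) auto
    then have "(LINT x|M. g x * real_cond_exp M F w x) = (LINT x|M. g x * w x)"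
      by (intro real_cond_exp_intg) auto
    moreover have "(LINT x|M. g x * u x) = (LINT x|M. g x * real_cond_exp M F w x)"
      using ae by (intro integral_cong_AE) (auto elim!: eventually_mono)
    ultimately show ?thesis by simp
  qed
  moreover have "\<bar>u x\<bar> \<le> K" for x
    using \<open>K \<ge> 0\<close> by (auto simp: u_def)
  ultimately show ?thesis
    using u_F by blast
qed

text \<open>No integrable function lies almost surely strictly below its own mean. Applied to
  \<open>h\<close> and to its negative, this rules out probability 1 for both level sets.\<close>

lemma AE_const_if_trivial:
  fixes h :: "'a \<Rightarrow> real"
  assumes h: "integrable M h"
    and "prob {x\<in>space M. h x < expectation h} \<in> {0, 1}" "prob {x\<in>space M. h x > expectation h} \<in> {0, 1}"
  shows "AE x in M. h x = expectation h"
proof -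
  have [measurable]: "h \<in> borel_measurable M"
    using h by auto
  have not_less: "prob {x\<in>space M. f x < expectation f} \<noteq> 1" if f: "integrable M f" for f :: "'a \<Rightarrow> real"
  proof
    assume "prob {x\<in>space M. f x < expectation f} = 1"
    moreover have [measurable]: "f \<in> borel_measurable M"
      using f by auto
    ultimately have "AE x in M. f x < expectation f"
      by (simp add: prob_Collect_eq_1)
    then have "expectation f < expectation (\<lambda>_. expectation f)"
      using f by (intro integral_less_AE_space) (auto simp: emeasure_space_1)
    then show False
      by (simp add: prob_space)
  qed
  have "prob {x\<in>space M. h x < expectation h} = 0"
    using assms(2) not_less[OF h] by auto
  moreover have "prob {x\<in>space M. h x > expectation h} = 0"
    using assms(3) not_less[of "\<lambda>x. - h x"] h by auto
  ultimately have "AE x in M. \<not> h x < expectation h" "AE x in M. \<not> h x > expectation h"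
    by (simp_all add: prob_Collect_eq_0)
  then show ?thesis
    by eventually_elim auto
qed

text \<open>The norms of the \<open>u n\<close> decrease, so \<open>u\<close> is Cauchy; an almost everywhere limit is measurable for every \<open>F n\<close>.\<close>
lemma reverse_martingale_tail_trivial:
  fixes u :: "nat \<Rightarrow> 'a \<Rightarrow> real"
  assumes F: "\<And>n. subalgebra M (F n)" "\<And>m n. m \<le> n \<Longrightarrow> subalgebra (F m) (F n)"
    and tail: "\<And>D. (\<And>n. D \<in> sets (F n)) \<Longrightarrow> prob D = 0 \<or> prob D = 1"
    and u: "\<And>n. u n \<in> borel_measurable (F n)" "\<And>n x. \<bar>u n x\<bar> \<le> K"
      "\<And>n g. g \<in> borel_measurable (F n) \<Longrightarrow> bounded (range g) \<Longrightarrow> (LINT x|M. g x * u n x) = (LINT x|M. g x * w x)"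
    and "e > 0"
  shows "\<exists>n. (LINT x|M. (u n x - (LINT x|M. w x))\<^sup>2) < e"
proof -
  have uF [measurable]: "u n \<in> borel_measurable (F m)" if "m \<le> n" for m n
    using u(1)[of n] by (rule measurable_from_subalg[OF F(2)[OF that]])
  have uM [measurable]: "u n \<in> borel_measurable M" for n
    using u(1)[of n] by (rule measurable_from_subalg[OF F(1)])
  have "K \<ge> 0"
    using u(2)[of 0 undefined] by linarith
  have bu: "bounded (range (u n))" for n
    by (rule boundedI[of _ K]) (use u(2) in auto)
  have int: "integrable M (u n)" "integrable M (\<lambda>x. u m x * u n x)" for m n
    by (intro integrable_bounded_range bounded_range_mult bu borel_measurable_times uM)+
  define c where "c n = (LINT x|M. u n x * u n x)" for n
  \<comment> \<open>Pythagoras: \<open>u n\<close> is the projection of \<open>u m\<close>. The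
    cross term is evaluated by testing against \<open>u n\<close> at both levels, since
    \<open>u n\<close> is also measurable for \<open>F m\<close>.\<close>
  have dist_eq: "(LINT x|M. (u m x - u n x)\<^sup>2) = c m - c n" if "m \<le> n" for m n
  proof -
    have "(LINT x|M. u n x * u m x) = (LINT x|M. u n x * w x)"
      using uF[OF that] bu by (rule u(3))
    also have "\<dots> = c n"
      unfolding c_def using u(1) bu by (rule u(3)[symmetric])
    finally have mn: "(LINT x|M. u n x * u m x) = c n" .
    have "(LINT x|M. (u m x - u n x)\<^sup>2) = (LINT x|M. u m x * u m x - 2 * (u n x * u m x) + u n x * u n x)"
      by (simp add: power2_eq_square algebra_simps)
    also have "\<dots> = c m - 2 * c n + c n"
      using int by (simp add: c_def mn[unfolded c_def])
    finally show ?thesis by simp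
  qed
  have "c n \<ge> 0" for n
    by (auto simp: c_def intro!: integral_nonneg)
  moreover have "decseq c"
  proof (rule decseq_SucI)
    show "c (Suc n) \<le> c n" for n
      using dist_eq[of n "Suc n"] Bochner_Integration.integral_nonneg[of M "\<lambda>x. (u n x - u (Suc n) x)\<^sup>2"] by simp
  qed
  ultimately obtain l where "c \<longlonglongrightarrow> l"
    using decseq_convergent[of c 0] by blast
  then have "Cauchy c"
    by (rule LIMSEQ_imp_Cauchy)
  \<comment> \<open>The extraction of an almost surely convergent subsequence is stated for L^1, so
    the L^2 bound is weakened by \<open>expectation_le_sqrt\<close>.\<close>
  have cauchy: "\<exists>N. \<forall>i\<ge>N. \<forall>j\<ge>N. (LINT x|M. norm (u i x - u j x)) < e" if "e > 0" for e
  proof -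
    obtain N where N: "\<And>i j. i \<ge> N \<Longrightarrow> j \<ge> N \<Longrightarrow> \<bar>c i - c j\<bar> < e\<^sup>2"
      using CauchyD[OF \<open>Cauchy c\<close>, of "e\<^sup>2"] \<open>e > 0\<close> by auto
    have bd: "bounded (range (\<lambda>x. u i x - u j x))" for i j
      using bounded_minus_comp[OF bu bu, of i j] by simp
    then have bd: "bounded (range (\<lambda>x. \<bar>u i x - u j x\<bar>))" for i j
      by (simp add: bounded_iff)
    have *: "(LINT x|M. norm (u i x - u j x)) < e" if "i \<le> j" "i \<ge> N" for i j
    proof -
      have "(LINT x|M. norm (u i x - u j x)) \<le> sqrt (LINT x|M. (norm (u i x - u j x))\<^sup>2)"
        unfolding power2_eq_square
        by (intro expectation_le_sqrt[unfolded power2_eq_square] integrable_bounded_range bounded_range_mult) (auto simp: bounded_norm_comp bd)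
      also have "\<dots> < e"
        using N[of i j] dist_eq[OF that(1)] that \<open>e > 0\<close> by (intro real_less_lsqrt) auto
      finally show ?thesis .
    qed
    have "(LINT x|M. norm (u i x - u j x)) < e" if "i \<ge> N" "j \<ge> N" for i j
      using *[of i j] *[of j i] that by (cases "i \<le> j") (auto simp: abs_minus_commute)
    then show ?thesis by blast
  qed
  from cauchy obtain r where r: "strict_mono r" "AE x in M. Cauchy (\<lambda>i. u (r i) x)"
    by (rule cauchy_L1_AE_cauchy_subseq[OF int(1)])
  \<comment> \<open>The clamp bounds \<open>h\<close> even where the sequence diverges and
    \<open>lim\<close> is an arbitrary value.\<close>
  define h where "h x = max (-K) (min K (lim (\<lambda>i. u (r i) x)))" for x
  have lim: "AE x in M. (\<lambda>i. u (r i) x) \<longlonglongrightarrow> h x"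
    using r(2)
  proof eventually_elim
    case (elim x)
    then have *: "(\<lambda>i. u (r i) x) \<longlonglongrightarrow> lim (\<lambda>i. u (r i) x)"
      by (simp only: Cauchy_convergent_iff convergent_LIMSEQ_iff)
    have "lim (\<lambda>i. u (r i) x) \<le> K" "- K \<le> lim (\<lambda>i. u (r i) x)"
      using u(2) by (auto intro!: LIMSEQ_le_const2[OF *] LIMSEQ_le_const[OF *] simp: abs_le_iff minus_le_iff)
    with * show ?case
      by (simp add: h_def)
  qed
  have hF: "h \<in> borel_measurable (F n)" for n
  proof -
    \<comment> \<open>Dropping the first \<open>n\<close> terms leaves \<open>lim\<close> unchanged
      even at points of divergence, because the defining predicates agree. All remaining terms have
      index at least \<open>n\<close>, hence are measurable for \<open>F n\<close>.\<close>
    have "lim (\<lambda>i. u (r i) x) = lim (\<lambda>i. u (r (i + n)) x)" for x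
      using LIMSEQ_ignore_initial_segment[of "\<lambda>i. u (r i) x" _ n] LIMSEQ_offset[of "\<lambda>i. u (r i) x" n]
      unfolding lim_def by (intro arg_cong[where f=The]) auto
    moreover have "n \<le> r (i + n)" for i
      using seq_suble[OF r(1), of "i + n"] by simp
    then have "(\<lambda>x. lim (\<lambda>i. u (r (i + n)) x)) \<in> borel_measurable (F n)"
      by (intro borel_measurable_lim_metric uF)
    ultimately show ?thesis
      unfolding h_def by simp
  qed
  then have [measurable]: "h \<in> borel_measurable M"
    using measurable_from_subalg[OF F(1)] by blast
  have hK: "\<bar>h x\<bar> \<le> K" for x
    using \<open>K \<ge> 0\<close> by (auto simp: h_def)
  have sp: "space (F n) = space M" for n
    using F(1) by (simp add: subalgebra_def)
  have "{x\<in>space M. h x < a} \<in> sets (F n)" "{x\<in>space M. h x > a} \<in> sets (F n)" for a n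
    using hF[of n] unfolding sp[of n, symmetric] by measurable
  then have "AE x in M. h x = expectation h"
    using hK by (intro AE_const_if_trivial integrable_const_bound[of _ K]) (auto intro!: tail)
  moreover have "expectation (u n) = expectation w" for n
    using u(3)[of "\<lambda>_. 1" n] by simp
  moreover have "(\<lambda>i. expectation (u (r i))) \<longlonglongrightarrow> expectation h"
    using lim u(2) by (intro integral_dominated_convergence[where w="\<lambda>_. K"]) auto
  ultimately have ae: "AE x in M. h x = expectation w"
    by (simp add: LIMSEQ_const_iff)
  have "(\<lambda>i. LINT x|M. (u (r i) x - expectation w)\<^sup>2) \<longlonglongrightarrow> (LINT x|M. 0)"
  proof (rule integral_dominated_convergence[where w="\<lambda>_. (K + \<bar>expectation w\<bar>)\<^sup>2"])
    show "AE x in M. (\<lambda>i. (u (r i) x - expectation w)\<^sup>2) \<longlonglongrightarrow> 0"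
      using lim ae
    proof eventually_elim
      case (elim x)
      then have "(\<lambda>i. (u (r i) x - expectation w)\<^sup>2) \<longlonglongrightarrow> (expectation w - expectation w)\<^sup>2"
        by (intro tendsto_intros) simp
      then show ?case by simp
    qed
    show "AE x in M. norm ((u (r i) x - expectation w)\<^sup>2) \<le> (K + \<bar>expectation w\<bar>)\<^sup>2" for i
    proof (rule AE_I2)
      fix x
      have "\<bar>u (r i) x - expectation w\<bar> \<le> K + \<bar>expectation w\<bar>"
        using u(2)[of "r i" x] by linarith
      then have "\<bar>u (r i) x - expectation w\<bar>\<^sup>2 \<le> (K + \<bar>expectation w\<bar>)\<^sup>2"
        by (intro power_mono) auto
      then show "norm ((u (r i) x - expectation w)\<^sup>2) \<le> (K + \<bar>expectation w\<bar>)\<^sup>2"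
        by simp
    qed
  qed auto
  then have "(\<lambda>i. LINT x|M. (u (r i) x - expectation w)\<^sup>2) \<longlonglongrightarrow> 0"
    by simp
  then show ?thesis
    using eventually_happens'[OF sequentially_bot order_tendstoD(2)[OF _ \<open>e > 0\<close>]] by blast
qed

end

section \<open>Density of innovations\<close>

context invariant_subalgebra
begin

lemma innovation_integral:
  assumes "f \<in> innovation L"
  shows "(LINT x|M. f x) = 0"
  using assms unfolding innovation_def by (auto dest!: bspec[of _ _ "\<lambda>_. 1"])

lemma innovation_add:
  assumes f: "f \<in> innovation L" and g: "g \<in> innovation L"
  shows "(\<lambda>x. f x + g x) \<in> innovation L"
proof -
  have [measurable]: "f \<in> borel_measurable B" "g \<in> borel_measurable B"
    using innovationD[OF f] innovationD[OF g] by auto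
  have "(LINT x|M. (f x + g x) * k ((T ^^ L) x)) = 0"
    if [measurable]: "k \<in> borel_measurable B" and k: "bounded (range k)" for k
  proof -
    have [measurable]: "f \<in> borel_measurable M" "g \<in> borel_measurable M" "k \<in> borel_measurable M"
      using innovationD[OF f] innovationD[OF g] measurable_B_M[OF that(1)] by auto
    have "integrable M (\<lambda>x. f x * k ((T ^^ L) x))" "integrable M (\<lambda>x. g x * k ((T ^^ L) x))"
      using innovationD(2)[OF f] innovationD(2)[OF g] k
      by (auto intro!: integrable_bounded_range bounded_range_mult bounded_range_compose[of k])
    then have "(LINT x|M. (f x + g x) * k ((T ^^ L) x))
        = (LINT x|M. f x * k ((T ^^ L) x)) + (LINT x|M. g x * k ((T ^^ L) x))"
      by (simp add: distrib_right)
    also have "\<dots> = 0"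
      using f g that by (simp add: innovation_def)
    finally show ?thesis .
  qed
  then show ?thesis
    using innovationD(2)[OF f] innovationD(2)[OF g] by (simp add: innovation_def bounded_range_add)
qed

lemma innovation_mult_const:
  assumes "f \<in> innovation L"
  shows "(\<lambda>x. c * f x) \<in> innovation L"
  using assms bounded_range_mult[of "\<lambda>_. c" f] by (auto simp: innovation_def mult.assoc)

text \<open>The pulled back algebras T^(-n) B as a decreasing filtration inside \<open>B\<close>;
  the inclusions come from writing \<open>T ^^ n\<close> as \<open>T ^^ (n - m)\<close> after
  \<open>T ^^ m\<close>.\<close>

lemma vimage_algebra_T_pow:
  "sets (vimage_algebra (space M) (T ^^ n) B) = {(T ^^ n) -` E \<inter> space M | E. E \<in> sets B}"
  "T ^^ n \<in> measurable (vimage_algebra (space M) (T ^^ n) B) B"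
  "m \<le> n \<Longrightarrow> subalgebra (vimage_algebra (space M) (T ^^ m) B) (vimage_algebra (space M) (T ^^ n) B)"
  "subalgebra B (vimage_algebra (space M) (T ^^ n) B)"
proof -
  have sp: "space B = space M"
    using subalgebra by (simp add: subalgebra_def)
  have maps: "T ^^ n \<in> space M \<rightarrow> space B" for n
    using measurable_space[OF T_pow_measurable_B[of n]] sp by auto
  show sets: "sets (vimage_algebra (space M) (T ^^ n) B) = {(T ^^ n) -` E \<inter> space M | E. E \<in> sets B}" for n
    by (rule sets_vimage_algebra2[OF maps])
  show "T ^^ n \<in> measurable (vimage_algebra (space M) (T ^^ n) B) B"
    by (rule measurable_vimage_algebra1[OF maps])
  have pre: "(T ^^ n) -` E \<inter> space M \<in> sets B" if "E \<in> sets B" for n E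
    using measurable_sets[OF T_pow_measurable_B[of n] that] by (simp add: sp)
  show "subalgebra B (vimage_algebra (space M) (T ^^ n) B)"
    using pre by (auto simp: subalgebra_def sp sets)
  show "subalgebra (vimage_algebra (space M) (T ^^ m) B) (vimage_algebra (space M) (T ^^ n) B)" if "m \<le> n"
  proof -
    have "\<exists>E'\<in>sets B. (T ^^ n) -` E \<inter> space M = (T ^^ m) -` E' \<inter> space M" if "E \<in> sets B" for E
    proof (rule bexI)
      have "(T ^^ n) x = (T ^^ (n - m)) ((T ^^ m) x)" for x
        using \<open>m \<le> n\<close> by (metis comp_apply funpow_add le_add_diff_inverse2)
      then show "(T ^^ n) -` E \<inter> space M = (T ^^ m) -` ((T ^^ (n - m)) -` E \<inter> space M) \<inter> space M"
        using maps[of m] sp by auto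
    qed (rule pre[OF that])
    then show ?thesis
      unfolding subalgebra_def sets by fastforce
  qed
qed

text \<open>Let \<open>u n\<close> represent the conditional expectation of the indicator
  \<open>w\<close> given T^(-n) B. Then \<open>w - u n\<close> is an innovation with
  \<open>L = n\<close>, and \<open>u n\<close> is close to the constant \<open>prob D\<close> by
  reverse martingale convergence.\<close>

lemma indicator_innovation_approx:
  assumes tail: "\<And>D. (\<And>n. \<exists>E\<in>sets B. D = (T ^^ n) -` E \<inter> space M) \<Longrightarrow> prob D = 0 \<or> prob D = 1"
    and D [measurable]: "D \<in> sets B" and "e > 0"
  shows "\<exists>L. \<exists>f\<in>innovation L. \<exists>c. (LINT x|M. (cmod (indicator D x - (c + f x)))\<^sup>2) < e"
proof -
  define F where "F n = vimage_algebra (space M) (T ^^ n) B" for n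
  note F = vimage_algebra_T_pow[folded F_def]
  have FM: "subalgebra M (F n)" for n
    using F(4)[of n] subalgebra by (auto simp: subalgebra_def)
  define w :: "'a \<Rightarrow> real" where "w = indicator D"
  have [measurable]: "w \<in> borel_measurable B"
    by (simp add: w_def)
  then have [measurable]: "w \<in> borel_measurable M"
    by (rule measurable_B_M)
  have w_le: "\<bar>w x\<bar> \<le> 1" for x
    by (simp add: w_def indicator_def)
  have "\<forall>n. \<exists>u. u \<in> borel_measurable (F n) \<and> (\<forall>x. \<bar>u x\<bar> \<le> 1) \<and>
      (\<forall>g\<in>borel_measurable (F n). bounded (range g) \<longrightarrow> (LINT x|M. g x * u x) = (LINT x|M. g x * w x))"
    using bounded_cond_exp_exists[OF FM \<open>w \<in> borel_measurable M\<close> w_le] unfolding Bex_def by (rule allI)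
  from choice[OF this] obtain u where "\<forall>n. u n \<in> borel_measurable (F n) \<and> (\<forall>x. \<bar>u n x\<bar> \<le> 1) \<and>
      (\<forall>g\<in>borel_measurable (F n). bounded (range g) \<longrightarrow> (LINT x|M. g x * u n x) = (LINT x|M. g x * w x))"
    by (rule exE)
  then have u: "\<And>n. u n \<in> borel_measurable (F n)" "\<And>n x. \<bar>u n x\<bar> \<le> 1"
    "\<And>n g. g \<in> borel_measurable (F n) \<Longrightarrow> bounded (range g) \<Longrightarrow> (LINT x|M. g x * u n x) = (LINT x|M. g x * w x)"
    by simp_all
  have tail_F: "prob D = 0 \<or> prob D = 1" if "\<And>n. D \<in> sets (F n)" for D
  proof (rule tail)
    show "\<exists>E\<in>sets B. D = (T ^^ n) -` E \<inter> space M" for n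
      using that[of n] unfolding F(1) by auto
  qed
  from reverse_martingale_tail_trivial[OF FM F(3) tail_F u \<open>e > 0\<close>]
  obtain n where n: "(LINT x|M. (u n x - (LINT x|M. w x))\<^sup>2) < e"
    by (rule exE)
  define f where "f x = complex_of_real (w x - u n x)" for x
  have uB [measurable]: "u n \<in> borel_measurable B"
    using u(1) by (rule measurable_from_subalg[OF F(4)])
  then have [measurable]: "u n \<in> borel_measurable M"
    by (rule measurable_B_M)
  have "\<bar>w x - u n x\<bar> \<le> 2" for x
    using u(2)[of n x] w_le[of x] by linarith
  then have bd: "bounded (range (\<lambda>x. w x - u n x))"
    by (auto intro!: boundedI[of _ 2])
  then have bf: "bounded (range f)"
    by (simp add: bounded_iff f_def del: of_real_diff)
  have bw: "bounded (range w)" and bu: "bounded (range (u n))"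
    using u(2) w_le by (auto intro!: boundedI[of _ 1])
  \<comment> \<open>Conditional expectation is real valued; complex test functions are split into
    real and imaginary parts afterwards.\<close>
  have real_test: "(LINT x|M. (w x - u n x) * g ((T ^^ n) x)) = 0"
    if [measurable]: "g \<in> borel_measurable B" and bg: "bounded (range g)" for g :: "'a \<Rightarrow> real"
  proof -
    have [measurable]: "g \<in> borel_measurable M"
      using that(1) by (rule measurable_B_M)
    have bgT: "bounded (range (\<lambda>x. g ((T ^^ n) x)))"
      using bg by (rule bounded_range_compose)
    have "(\<lambda>x. g ((T ^^ n) x)) \<in> borel_measurable (F n)"
      using measurable_compose[OF F(2) that(1)] .
    then have "(LINT x|M. g ((T ^^ n) x) * u n x) = (LINT x|M. g ((T ^^ n) x) * w x)"
      using bgT by (rule u(3))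
    moreover have "integrable M (\<lambda>x. g ((T ^^ n) x) * u n x)" "integrable M (\<lambda>x. g ((T ^^ n) x) * w x)"
      by (auto intro!: integrable_bounded_range bounded_range_mult bgT bw bu)
    ultimately show ?thesis
      by (simp add: mult.commute[of _ "g _"] right_diff_distrib)
  qed
  have "(LINT x|M. f x * g ((T ^^ n) x)) = 0"
    if [measurable]: "g \<in> borel_measurable B" and bg: "bounded (range g)" for g
  proof -
    have [measurable]: "g \<in> borel_measurable M"
      using that(1) by (rule measurable_B_M)
    have bgT: "bounded (range (\<lambda>x. g ((T ^^ n) x)))"
      using bg by (rule bounded_range_compose)
    have "integrable M (\<lambda>x. f x * g ((T ^^ n) x))"
      by (rule integrable_bounded_range) (auto simp: f_def simp del: of_real_diff intro!: bounded_range_mult bgT bf[unfolded f_def])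
    note int = integral_Re[OF this] integral_Im[OF this]
    have "bounded (range (\<lambda>x. Re (g x)))" "bounded (range (\<lambda>x. Im (g x)))"
      using bg by (auto simp: bounded_iff intro: order_trans[OF abs_Re_le_cmod] order_trans[OF abs_Im_le_cmod])
    then have "(LINT x|M. (w x - u n x) * Re (g ((T ^^ n) x))) = 0" "(LINT x|M. (w x - u n x) * Im (g ((T ^^ n) x))) = 0"
      using real_test[of "\<lambda>x. Re (g x)"] real_test[of "\<lambda>x. Im (g x)"] by simp_all
    then show ?thesis
      unfolding complex_eq_iff int[symmetric] by (simp add: f_def)
  qed
  then have "f \<in> innovation n"
    using bf unfolding innovation_def by (simp add: f_def[abs_def] del: of_real_diff)
  moreover have "(LINT x|M. (cmod (indicator D x - (of_real (LINT x|M. w x) + f x)))\<^sup>2) = (LINT x|M. (u n x - (LINT x|M. w x))\<^sup>2)"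
  proof (intro Bochner_Integration.integral_cong refl)
    fix x
    have "indicator D x - (of_real (LINT x|M. w x) + f x) = complex_of_real (u n x - (LINT x|M. w x))"
      by (simp add: f_def w_def indicator_def)
    then show "(cmod (indicator D x - (of_real (LINT x|M. w x) + f x)))\<^sup>2 = (u n x - (LINT x|M. w x))\<^sup>2"
      by (simp only: norm_of_real power2_abs)
  qed
  ultimately show ?thesis
    using n by metis
qed

end

section \<open>Square-integrable functions on finite measure spaces\<close>

lemma (in finite_measure) L2_const: "(\<lambda>_. c) \<in> L2 M"
  by (simp add: L2_def)

lemma (in finite_measure) Linf_L2:
  assumes "f \<in> Linf M"
  shows "f \<in> L2 M"
proof -
  have [measurable]: "f \<in> borel_measurable M"
    using assms by (simp add: Linf_def)
  obtain C where "AE x in M. cmod (f x) \<le> C"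
    using assms by (auto simp: Linf_def)
  then have "AE x in M. norm ((cmod (f x))\<^sup>2) \<le> C\<^sup>2"
    by eventually_elim (simp add: power_mono)
  then have "integrable M (\<lambda>x. (cmod (f x))\<^sup>2)"
    by (rule integrable_const_bound) measurable
  then show ?thesis
    by (simp add: L2_def)
qed

lemma (in prob_space) L2_integrable:
  assumes "f \<in> L2 M"
  shows "integrable M f"
proof (rule Bochner_Integration.integrable_bound)
  show "integrable M (\<lambda>x. 1 + (cmod (f x))\<^sup>2)"
    using assms by (simp add: L2_def)
  have "cmod (f x) \<le> 1 + (cmod (f x))\<^sup>2" for x
    using zero_le_power2[of "cmod (f x) - 1/2"] by (simp add: power2_eq_square algebra_simps)
  then show "AE x in M. cmod (f x) \<le> norm (1 + (cmod (f x))\<^sup>2)"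
    by (auto intro: order_trans)
qed (use assms in \<open>auto simp: L2_def\<close>)

lemma (in prob_space) norm_integral_square_le:
  assumes "f \<in> L2 M"
  shows "(cmod (LINT x|M. f x))\<^sup>2 \<le> (LINT x|M. (cmod (f x))\<^sup>2)"
proof -
  have "cmod (LINT x|M. f x) \<le> (LINT x|M. cmod (f x))"
    by (rule integral_norm_bound)
  also have "\<dots> \<le> sqrt (LINT x|M. (cmod (f x))\<^sup>2)"
    using L2_integrable[OF assms] assms by (intro expectation_le_sqrt) (auto simp: L2_def)
  finally have "(cmod (LINT x|M. f x))\<^sup>2 \<le> (sqrt (LINT x|M. (cmod (f x))\<^sup>2))\<^sup>2"
    by (intro power_mono) auto
  then show ?thesis
    by (simp add: integral_nonneg)
qed

section \<open>The increasing algebras T^n A of a Kolmogorov system\<close>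

locale kolmogorov_filtration = invertible_system +
  fixes A :: "'a measure"
  assumes sub_A: "subalgebra M A"
    and T_A: "T \<in> measurable A A"
    and tail_A: "\<And>D. (\<And>n. \<exists>E\<in>sets A. D = (T ^^ n) -` E \<inter> space M) \<Longrightarrow> prob D = 0 \<or> prob D = 1"
    and gen_A: "\<And>D. D \<in> sets M \<Longrightarrow>
      \<exists>C\<in>sigma_sets (space M) (\<Union>n. image_sets T n A). (D - C) \<union> (C - D) \<in> null_sets M"
begin

definition S :: "'a \<Rightarrow> 'a" where "S = the_inv_into (space M) T"

text \<open>This is T^n A: images under \<open>T ^^ n\<close> are preimages under the inverse
  \<open>S ^^ n\<close>, and as a pullback it admits a simple criterion for maps into it.\<close>

definition B :: "nat \<Rightarrow> 'a measure" where "B n = vimage_algebra (space M) (S ^^ n) A"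

lemma space_A [simp]: "space A = space M"
  using sub_A by (simp add: subalgebra_def)

lemma space_B [simp]: "space (B n) = space M"
  by (simp add: B_def)

lemma S_measurable: "S \<in> measurable M M"
  unfolding S_def by (rule T_inv_measurable)

lemma S_pow_measurable: "S ^^ n \<in> measurable M M"
  using S_measurable by (rule measurable_compose_n)

lemma T_pow_A: "T ^^ n \<in> measurable A A"
  using T_A by (rule measurable_compose_n)

lemma T_pow_space: "x \<in> space M \<Longrightarrow> (T ^^ n) x \<in> space M"
  by (rule measurable_space[OF T_pow_measurable])

lemma S_pow_space: "x \<in> space M \<Longrightarrow> (S ^^ n) x \<in> space M"
  by (rule measurable_space[OF S_pow_measurable])

lemma S_T: "x \<in> space M \<Longrightarrow> S (T x) = x"
  unfolding S_def using T_bij by (intro the_inv_into_f_f) (auto simp: bij_betw_def)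

lemma T_S: "x \<in> space M \<Longrightarrow> T (S x) = x"
  unfolding S_def using T_bij by (intro f_the_inv_into_f_bij_betw) auto

lemma S_T_pow: "x \<in> space M \<Longrightarrow> (S ^^ n) ((T ^^ n) x) = x"
proof (induction n arbitrary: x)
  case (Suc n)
  then have "(S ^^ Suc n) ((T ^^ Suc n) x) = S ((S ^^ n) ((T ^^ n) (T x)))"
    by (simp add: funpow_swap1)
  then show ?case
    using Suc T_pow_space[of x 1] by (simp add: S_T)
qed simp

lemma T_S_pow: "x \<in> space M \<Longrightarrow> (T ^^ n) ((S ^^ n) x) = x"
proof (induction n arbitrary: x)
  case (Suc n)
  then have "(T ^^ Suc n) ((S ^^ Suc n) x) = T ((T ^^ n) ((S ^^ n) (S x)))"
    by (simp add: funpow_swap1)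
  then show ?case
    using Suc S_pow_space[of x 1] by (simp add: T_S)
qed simp

lemma S_pow_T_pow_add: "x \<in> space M \<Longrightarrow> (S ^^ (n + d)) ((T ^^ d) x) = (S ^^ n) x"
  by (simp add: funpow_add S_T_pow)

lemma T_pow_S_pow_add: "x \<in> space M \<Longrightarrow> (T ^^ d) ((S ^^ (n + d)) x) = (S ^^ n) x"
  by (simp add: add.commute[of n] funpow_add T_S_pow S_pow_space)

lemma measurable_into_B:
  assumes "g \<in> space N \<rightarrow> space M" "(\<lambda>x. (S ^^ n) (g x)) \<in> measurable N A"
  shows "g \<in> measurable N (B n)"
  unfolding B_def using assms by (rule measurable_vimage_algebra2)

lemma S_pow_measurable_B: "S ^^ n \<in> measurable (B n) A"
  unfolding B_def by (rule measurable_vimage_algebra1) (simp add: S_pow_space)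

lemma T_measurable_B: "T \<in> measurable (B n) (B n)"
proof (rule measurable_into_B)
  show "T \<in> space (B n) \<rightarrow> space M"
    using T_pow_space[of _ 1] by simp
  have "(\<lambda>x. T ((S ^^ n) x)) \<in> measurable (B n) A"
    by (rule measurable_compose[OF S_pow_measurable_B T_A])
  \<comment> \<open>Commutation is claimed only on \<open>space M\<close>, where \<open>S\<close>
    inverts \<open>T\<close>.\<close>
  moreover have "(S ^^ n) (T x) = T ((S ^^ n) x)" if "x \<in> space M" for x
  proof (cases n)
    case (Suc m)
    have "(S ^^ n) (T x) = (S ^^ m) x"
      using S_pow_T_pow_add[OF that, of m 1] Suc by simp
    also have "\<dots> = T ((S ^^ n) x)"
      using T_pow_S_pow_add[OF that, of 1 m] Suc by simp
    finally show ?thesis .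
  qed simp
  ultimately show "(\<lambda>x. (S ^^ n) (T x)) \<in> measurable (B n) A"
    by (subst measurable_cong[where g="\<lambda>x. T ((S ^^ n) x)"]) auto
qed

lemma subalgebra_B: "subalgebra M (B n)"
proof -
  have "S ^^ n \<in> measurable M A"
    using sub_A measurable_sets[OF S_pow_measurable] S_pow_space
    by (intro measurableI) (auto simp: subalgebra_def)
  then have "(\<lambda>x. x) \<in> measurable M (B n)"
    by (intro measurable_into_B) auto
  then show ?thesis
    by (auto simp: subalgebra_def dest!: measurable_sets dest: sets.sets_into_space) (metis Int_absorb2 sets.sets_into_space space_B)
qed

text \<open>On the space, \<open>S ^^ (n + d)\<close> after \<open>T ^^ d\<close> is
  \<open>S ^^ n\<close>.\<close>

lemma T_pow_measurable_B_add: "T ^^ d \<in> measurable (B n) (B (n + d))"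
proof (rule measurable_into_B)
  show "(\<lambda>x. (S ^^ (n + d)) ((T ^^ d) x)) \<in> measurable (B n) A"
    using S_pow_measurable_B[of n] by (subst measurable_cong[where g="S ^^ n"]) (auto simp: S_pow_T_pow_add)
qed (simp add: T_pow_space)

text \<open>Here \<open>S ^^ n\<close> is recovered as \<open>T ^^ d\<close> after
  \<open>S ^^ (n + d)\<close>, and \<open>T ^^ d\<close> is measurable for \<open>A\<close>.\<close>

lemma B_mono: "subalgebra (B (n + d)) (B n)"
proof -
  have "(\<lambda>x. (T ^^ d) ((S ^^ (n + d)) x)) \<in> measurable (B (n + d)) A"
    by (rule measurable_compose[OF S_pow_measurable_B T_pow_A])
  then have "S ^^ n \<in> measurable (B (n + d)) A"
    by (subst measurable_cong[where g="\<lambda>x. (T ^^ d) ((S ^^ (n + d)) x)"]) (auto simp: T_pow_S_pow_add)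
  then have "(\<lambda>x. x) \<in> measurable (B (n + d)) (B n)"
    by (intro measurable_into_B) auto
  then show ?thesis
    by (auto simp: subalgebra_def dest!: measurable_sets) (metis Int_absorb2 sets.sets_into_space space_B)
qed

lemma invariant_subalgebra_B: "invariant_subalgebra M T (B n)"
  by unfold_locales (rule subalgebra_B T_measurable_B)+

abbreviation innov :: "nat \<Rightarrow> nat \<Rightarrow> ('a \<Rightarrow> complex) set" where
  "innov n L \<equiv> invariant_subalgebra.innovation M T (B n) L"

lemmas innov_def = invariant_subalgebra.innovation_def[OF invariant_subalgebra_B]

text \<open>Enlarging the algebra from \<open>B n\<close> to \<open>B n'\<close> is offset by a
  later gap: pulling \<open>B (n + d)\<close> back along \<open>T ^^ (L + d)\<close> gives the same
  algebra as pulling \<open>B n\<close> back along \<open>T ^^ L\<close>.\<close>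

lemma innov_mono:
  assumes "f \<in> innov n L" "n \<le> n'"
  shows "f \<in> innov n' (L + (n' - n))"
proof -
  define d where "d = n' - n"
  have n': "n' = n + d"
    using assms(2) by (simp add: d_def)
  have "(LINT x|M. f x * g ((T ^^ (L + d)) x)) = 0"
    if "g \<in> borel_measurable (B n')" "bounded (range g)" for g
  proof -
    have "(\<lambda>x. g ((T ^^ d) x)) \<in> borel_measurable (B n)"
      using that(1) unfolding n' by (rule measurable_compose[OF T_pow_measurable_B_add])
    moreover have "bounded (range (\<lambda>x. g ((T ^^ d) x)))"
      using that(2) by (rule bounded_range_compose)
    ultimately have "(LINT x|M. f x * g ((T ^^ d) ((T ^^ L) x))) = 0"
      using assms(1) unfolding innov_def by blast
    then show ?thesis
      by (simp add: add.commute[of L] funpow_add)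
  qed
  moreover have "f \<in> borel_measurable (B n')"
    using assms(1) measurable_from_subalg[OF B_mono[of n d]] unfolding innov_def n' by blast
  ultimately show ?thesis
    using assms(1) by (simp add: innov_def d_def)
qed

lemma innov_mono':
  assumes "f \<in> innov n L" "n \<le> n'" "L + n' \<le> L'"
  shows "f \<in> innov n' L'"
  using invariant_subalgebra.innovation_mono[OF invariant_subalgebra_B innov_mono[OF assms(1,2)]] assms(3) by simp

text \<open>Pulling \<open>B n\<close> back along \<open>T ^^ (n + j)\<close> gives the pullback of
  \<open>A\<close> along \<open>T ^^ j\<close>, so a tail set of \<open>B n\<close> is a tail set of
  \<open>A\<close>.\<close>

lemma tail_B:
  assumes "\<And>m. \<exists>E\<in>sets (B n). D = (T ^^ m) -` E \<inter> space M"
  shows "prob D = 0 \<or> prob D = 1"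
proof (rule tail_A)
  fix j
  obtain E where E: "E \<in> sets (B n)" "D = (T ^^ (n + j)) -` E \<inter> space M"
    using assms by blast
  have "sets (B n) = {(S ^^ n) -` A' \<inter> space M | A'. A' \<in> sets A}"
    unfolding B_def by (rule sets_vimage_algebra2) (simp add: S_pow_space)
  then obtain A' where A': "A' \<in> sets A" "E = (S ^^ n) -` A' \<inter> space M"
    using E(1) by blast
  have "(S ^^ n) ((T ^^ (n + j)) x) = (T ^^ j) x" if "x \<in> space M" for x
    using that by (simp add: funpow_add S_T_pow T_pow_space)
  then have "D = (T ^^ j) -` A' \<inter> space M"
    unfolding E(2) A'(2) using T_pow_space by auto
  then show "\<exists>E\<in>sets A. D = (T ^^ j) -` E \<inter> space M"
    using A'(1) by blast
qed

lemma image_sets_subset_B: "image_sets T n A \<subseteq> sets (B n)"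
proof
  fix D
  assume "D \<in> image_sets T n A"
  then obtain E where E: "E \<in> sets A" "D = (T ^^ n) ` E"
    by (auto simp: image_sets_def)
  then have "E \<subseteq> space M"
    using sets.sets_into_space by fastforce
  then have "D = (S ^^ n) -` E \<inter> space (B n)"
    unfolding E(2) by (auto simp: S_T_pow T_pow_space subset_iff) (metis T_S_pow imageI)
  then show "D \<in> sets (B n)"
    using measurable_sets[OF S_pow_measurable_B E(1)] by simp
qed

lemma innov_L2: "f \<in> innov n L \<Longrightarrow> f \<in> L2 M"
proof -
  assume f: "f \<in> innov n L"
  have [measurable]: "f \<in> borel_measurable M" and bf: "bounded (range f)"
    using invariant_subalgebra.innovationD[OF invariant_subalgebra_B f] by auto
  have "integrable M (\<lambda>x. (cmod (f x))\<^sup>2)"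
    unfolding power2_eq_square
    by (intro integrable_bounded_range bounded_range_mult) (auto simp: bounded_norm_comp bf)
  then show "f \<in> L2 M"
    by (simp add: L2_def)
qed

text \<open>Constants are included because indicators are not centred. The union of the
  \<open>sets (B n)\<close> is a pi-system as the algebras increase, it generates modulo null sets
  by the K property, and its indicators are approximated at their own level.\<close>

lemma innov_affine_dense: "L2_closure M {(\<lambda>x. c + f x) | c f n L. f \<in> innov n L} = L2 M"
proof (rule L2_closure_eqI)
  let ?V = "{(\<lambda>x. c + f x) | c f n L. f \<in> innov n L}"
  let ?G = "\<Union>n. sets (B n)"
  show V: "?V \<subseteq> L2 M"
    using L2_add[OF L2_const innov_L2] by blast
  have zero: "(\<lambda>_. 0) \<in> innov 0 0"
    by (simp add: innov_def)
  then show "?V \<noteq> {}"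
    by blast
  show "(\<lambda>x. v x + w x) \<in> ?V" if vw: "v \<in> ?V" "w \<in> ?V" for v w
  proof -
    obtain c f n L d g m K where *: "v = (\<lambda>x. c + f x)" "f \<in> innov n L" "w = (\<lambda>x. d + g x)" "g \<in> innov m K"
      using vw by blast
    \<comment> \<open>A common level for both summands; \<open>L'\<close> is large enough for the
      hypothesis of \<open>innov_mono'\<close> on either side.\<close>
    define n' where "n' = max n m"
    define L' where "L' = max L K + n'"
    have "f \<in> innov n' L'" "g \<in> innov n' L'"
      by (rule innov_mono'[OF *(2)] innov_mono'[OF *(4)]; simp add: n'_def L'_def)+
    then have "(\<lambda>x. f x + g x) \<in> innov n' L'"
      by (rule invariant_subalgebra.innovation_add[OF invariant_subalgebra_B])
    moreover have "(\<lambda>x. v x + w x) = (\<lambda>x. (c + d) + (f x + g x))"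
      by (simp add: * algebra_simps)
    ultimately show ?thesis
      by (intro CollectI exI conjI)
  qed
  show "(\<lambda>x. a * v x) \<in> ?V" if v: "v \<in> ?V" for v a
  proof -
    obtain c f n L where *: "v = (\<lambda>x. c + f x)" "f \<in> innov n L"
      using v by blast
    then have "(\<lambda>x. a * f x) \<in> innov n L"
      by (intro invariant_subalgebra.innovation_mult_const[OF invariant_subalgebra_B])
    moreover have "(\<lambda>x. a * v x) = (\<lambda>x. a * c + a * f x)"
      by (simp add: * distrib_left)
    ultimately show ?thesis
      by (intro CollectI exI conjI)
  qed
  have mono: "D \<in> sets (B m)" if "D \<in> sets (B n)" "n \<le> m" for D n m
    using B_mono[of n "m - n"] that by (auto simp: subalgebra_def)
  show "Int_stable ?G"
  proof (rule Int_stableI)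
    fix D E
    assume "D \<in> ?G" "E \<in> ?G"
    then obtain n m where "D \<in> sets (B n)" "E \<in> sets (B m)"
      by blast
    then have "D \<in> sets (B (max n m))" "E \<in> sets (B (max n m))"
      by (auto intro: mono)
    then show "D \<inter> E \<in> ?G"
      by blast
  qed
  show "?G \<subseteq> sets M"
    using subalgebra_B by (auto simp: subalgebra_def)
  have "sigma_sets (space M) (\<Union>n. image_sets T n A) \<subseteq> sigma_sets (space M) ?G"
    by (intro sigma_sets_mono' UN_mono image_sets_subset_B order_refl)
  then show "\<exists>C\<in>sigma_sets (space M) ?G. (D - C) \<union> (C - D) \<in> null_sets M" if "D \<in> sets M" for D
    using gen_A[OF that] by (meson subsetD)
  show "indicator D \<in> L2_closure M ?V" if "D \<in> insert (space M) ?G" for D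
  proof -
    have "space M \<in> sets (B 0)"
      using sets.top[of "B 0"] by simp
    then have "D \<in> ?G"
      using that by blast
    then obtain n where D: "D \<in> sets (B n)"
      by blast
    then have DM: "D \<in> sets M"
      using subalgebra_B by (auto simp: subalgebra_def)
    have approx: "\<exists>v\<in>?V. (LINT x|M. (cmod (indicator D x - v x))\<^sup>2) < e" if e: "e > 0" for e
    proof -
      have "\<exists>L. \<exists>f\<in>innov n L. \<exists>c. (LINT x|M. (cmod (indicator D x - (c + f x)))\<^sup>2) < e"
        by (rule invariant_subalgebra.indicator_innovation_approx[OF invariant_subalgebra_B _ D e]) (rule tail_B)
      then obtain L f c where f: "f \<in> innov n L" and lt: "(LINT x|M. (cmod (indicator D x - (c + f x)))\<^sup>2) < e"
        by (elim exE bexE)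
      have "(\<lambda>x. c + f x) \<in> ?V"
        using f by (intro CollectI exI[of _ c] exI[of _ f] exI conjI refl)
      with lt show ?thesis
        by (rule bexI)
    qed
    have "integrable M (\<lambda>x. (cmod (indicator D x))\<^sup>2)"
      using DM by (intro integrable_const_bound[of _ 1]) (auto simp: indicator_def)
    then have "indicator D \<in> L2 M"
      using DM by (simp add: L2_def)
    then show ?thesis
      unfolding L2_closure_def by (intro CollectI conjI allI impI approx)
  qed
qed

lemma innov_dense:
  assumes v: "v \<in> L2 M" "(LINT x|M. v x) = 0" and "e > 0"
  shows "\<exists>n L. \<exists>f\<in>innov n L. (LINT x|M. (cmod (v x - f x))\<^sup>2) < e"
proof -
  have "e / 4 > 0"
    using \<open>e > 0\<close> by simp
  moreover have "v \<in> L2_closure M {(\<lambda>x. c + f x) | c f n L. f \<in> innov n L}"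
    using v(1) innov_affine_dense by simp
  ultimately obtain c f n L where f: "f \<in> innov n L" and e: "(LINT x|M. (cmod (v x - (c + f x)))\<^sup>2) < e / 4"
    unfolding L2_closure_def by blast
  have L2: "(\<lambda>x. v x - (c + f x)) \<in> L2 M"
    by (intro L2_diff L2_add L2_const innov_L2[OF f] v)
  have "(LINT x|M. v x - (c + f x)) = (LINT x|M. v x) - (c + (LINT x|M. f x))"
    using L2_integrable[OF v(1)] L2_integrable[OF innov_L2[OF f]] by (simp add: prob_space)
  also have "\<dots> = - c"
    using v(2) invariant_subalgebra.innovation_integral[OF invariant_subalgebra_B f] by simp
  finally have "(cmod c)\<^sup>2 < e / 4"
    using norm_integral_square_le[OF L2] e by simp
  have "(LINT x|M. (cmod (v x - f x))\<^sup>2) = (LINT x|M. (cmod ((v x - (c + f x)) + c))\<^sup>2)"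
    by (simp add: algebra_simps)
  also have "\<dots> \<le> 2 * (LINT x|M. (cmod (v x - (c + f x)))\<^sup>2) + 2 * (LINT x|M. (cmod c)\<^sup>2)"
    by (intro integral_norm_add_square_le L2 L2_const)
  also have "\<dots> < e"
    using e \<open>(cmod c)\<^sup>2 < e / 4\<close> by (simp add: prob_space)
  finally show ?thesis
    using f by blast
qed

end

section \<open>Mixing and triviality of the factors\<close>

lemma cesaro_mean_tendsto:
  fixes a :: "nat \<Rightarrow> real"
  assumes "a \<longlonglongrightarrow> l"
  shows "(\<lambda>H. (1 / real H) * (\<Sum>h=1..H. a h)) \<longlonglongrightarrow> l"
proof (rule LIMSEQ_I)
  fix e :: real
  assume "e > 0"
  then obtain N where N: "\<And>h. h \<ge> N \<Longrightarrow> \<bar>a h - l\<bar> < e / 2"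
    using LIMSEQ_D[OF assms, of "e / 2"] by auto
  define C where "C = (\<Sum>h=1..N. \<bar>a h - l\<bar>)"
  \<comment> \<open>Beyond \<open>m\<close> the fixed initial deviation \<open>C\<close> is less
    than half of \<open>H * e\<close>.\<close>
  obtain m :: nat where m: "2 * C / e < real m"
    using reals_Archimedean2 by blast
  have "\<bar>(1 / real H) * (\<Sum>h=1..H. a h) - l\<bar> < e" if "H \<ge> max 1 (max N m)" for H
  proof -
    have H: "real H > 0" "H \<ge> N" "2 * C / e < real H"
      using that m by auto
    have "(\<Sum>h=1..H. a h) - real H * l = (\<Sum>h=1..H. a h - l)"
      by (simp add: sum_subtractf)
    also have "\<bar>\<dots>\<bar> \<le> (\<Sum>h=1..H. \<bar>a h - l\<bar>)"
      by (rule sum_abs)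
    also have "\<dots> \<le> C + (\<Sum>h\<in>{N<..H}. \<bar>a h - l\<bar>)"
      unfolding C_def using H(2) by (subst sum.union_disjoint[symmetric]) (auto intro!: sum_mono2)
    also have "(\<Sum>h\<in>{N<..H}. \<bar>a h - l\<bar>) \<le> (\<Sum>h\<in>{N<..H}. e / 2)"
      using N by (intro sum_mono) (auto intro: less_imp_le)
    also have "\<dots> \<le> real H * (e / 2)"
      using \<open>e > 0\<close> by auto
    also have "C + real H * (e / 2) < real H * e"
      using H(3) \<open>e > 0\<close> by (simp add: field_simps)
    finally have "\<bar>(\<Sum>h=1..H. a h) - real H * l\<bar> < real H * e"
      by simp
    moreover have "(1 / real H) * (\<Sum>h=1..H. a h) - l = ((\<Sum>h=1..H. a h) - real H * l) / real H"
      using H(1) by (simp add: field_simps)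
    ultimately show ?thesis
      using H(1) by (simp add: abs_divide divide_less_eq mult.commute)
  qed
  then show "\<exists>no. \<forall>H\<ge>no. norm ((1 / real H) * (\<Sum>h=1..H. a h) - l) < e"
    by (intro exI[of _ "max 1 (max N m)"]) simp
qed

text \<open>The weighted arithmetic-geometric mean inequality in place of Cauchy-Schwarz; the same
  majorant yields integrability of the product.\<close>

lemma (in prob_space) integral_mult_le_weighted:
  assumes f: "f \<in> L2 M" and g: "g \<in> L2 M" and "\<eta> > 0"
    and F: "(LINT x|M. (cmod (f x))\<^sup>2) \<le> \<eta>\<^sup>2" and G: "(LINT x|M. (cmod (g x))\<^sup>2) \<le> K"
  shows "cmod (LINT x|M. f x * g x) \<le> \<eta> * (K + 1) / 2" "integrable M (\<lambda>x. f x * g x)"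
proof -
  have [measurable]: "f \<in> borel_measurable M" "g \<in> borel_measurable M"
    using f g by (auto simp: L2_def)
  let ?b = "\<lambda>x. \<eta> * (cmod (g x))\<^sup>2 / 2 + (cmod (f x))\<^sup>2 / (2 * \<eta>)"
  have b: "integrable M ?b"
    using f g by (simp add: L2_def)
  have le: "cmod (f x * g x) \<le> ?b x" for x
  proof -
    have "2 * \<eta> * (cmod (f x) * cmod (g x)) \<le> \<eta>\<^sup>2 * (cmod (g x))\<^sup>2 + (cmod (f x))\<^sup>2"
      using zero_le_power2[of "\<eta> * cmod (g x) - cmod (f x)"] by (simp add: power2_eq_square algebra_simps)
    then show ?thesis
      using \<open>\<eta> > 0\<close> by (simp add: norm_mult field_simps power2_eq_square)
  qed
  show int: "integrable M (\<lambda>x. f x * g x)"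
    by (rule Bochner_Integration.integrable_bound[OF b]) (auto intro: order_trans[OF le abs_ge_self])
  have "cmod (LINT x|M. f x * g x) \<le> (LINT x|M. cmod (f x * g x))"
    by (rule integral_norm_bound)
  also have "\<dots> \<le> (LINT x|M. ?b x)"
    using int b le by (intro integral_mono) auto
  also have "\<dots> = \<eta> * (LINT x|M. (cmod (g x))\<^sup>2) / 2 + (LINT x|M. (cmod (f x))\<^sup>2) / (2 * \<eta>)"
    using f g by (subst Bochner_Integration.integral_add) (auto simp: L2_def)
  also have "\<dots> \<le> \<eta> * K / 2 + \<eta>\<^sup>2 / (2 * \<eta>)"
    using F G \<open>\<eta> > 0\<close> by (intro add_mono divide_right_mono mult_left_mono) auto
  also have "\<dots> = \<eta> * (K + 1) / 2"
    using \<open>\<eta> > 0\<close> by (simp add: field_simps power2_eq_square)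
  finally show "cmod (LINT x|M. f x * g x) \<le> \<eta> * (K + 1) / 2" .
qed

section \<open>The trivial sigma-algebra\<close>

context prob_space
begin

definition trivial_alg :: "'a measure" where
  "trivial_alg = sigma (space M) {}"

lemma trivial_alg: "space trivial_alg = space M" "sets trivial_alg = {{}, space M}"
  by (auto simp: trivial_alg_def sigma_sets_empty_eq)

lemma real_cond_exp_trivial_alg:
  assumes "integrable M u"
  shows "AE x in M. real_cond_exp M trivial_alg u x = (LINT x|M. u x)"
proof -
  have sub: "subalgebra M trivial_alg"
    by (auto simp: subalgebra_def trivial_alg)
  interpret finite_measure_subalgebra M trivial_alg
    using sub by unfold_locales
  show ?thesis
  proof (rule real_cond_exp_charact)
    fix D
    assume "D \<in> sets trivial_alg"
    then consider "D = {}" | "D = space M"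
      by (auto simp: trivial_alg)
    then show "(LINT x:D|M. u x) = (LINT x:D|M. (LINT x|M. u x))"
      by cases (simp_all add: set_integral_space assms prob_space set_lebesgue_integral_def[of M "{}"])
  qed (use assms in auto)
qed

lemma complex_cond_exp_trivial_alg:
  assumes "integrable M f"
  shows "(AE x in M. complex_cond_exp M trivial_alg f x = 0) \<longleftrightarrow> (LINT x|M. f x) = 0"
proof -
  have "AE x in M. real_cond_exp M trivial_alg (\<lambda>y. Re (f y)) x = Re (LINT x|M. f x)"
    "AE x in M. real_cond_exp M trivial_alg (\<lambda>y. Im (f y)) x = Im (LINT x|M. f x)"
    using real_cond_exp_trivial_alg[of "\<lambda>y. Re (f y)"] real_cond_exp_trivial_alg[of "\<lambda>y. Im (f y)"] assms
    by auto
  then have eq: "AE x in M. complex_cond_exp M trivial_alg f x = (LINT x|M. f x)"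
    by eventually_elim (simp add: complex_cond_exp_def)
  show ?thesis
  proof
    assume "AE x in M. complex_cond_exp M trivial_alg f x = 0"
    then have "AE x in M. (LINT x|M. f x) = 0"
      using eq by eventually_elim simp
    then show "(LINT x|M. f x) = 0"
      by simp
  next
    assume "(LINT x|M. f x) = 0"
    then show "AE x in M. complex_cond_exp M trivial_alg f x = 0"
      using eq by simp
  qed
qed

end

lemma (in mp_system) Linf_correlation:
  assumes "f \<in> Linf M"
  shows "(\<lambda>x. f x * cnj (f ((T ^^ h) x))) \<in> Linf M"
proof -
  have [measurable]: "f \<in> borel_measurable M"
    using assms by (simp add: Linf_def)
  obtain C where C: "AE x in M. cmod (f x) \<le> C"
    using assms by (auto simp: Linf_def)
  then have "AE x in M. cmod (f x * cnj (f ((T ^^ h) x))) \<le> C * C"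
    using AE_T_pow[OF C, of h]
  proof eventually_elim
    case (elim x)
    then have "C \<ge> 0"
      using norm_ge_zero order_trans by blast
    with elim show ?case
      by (auto simp: norm_mult intro!: mult_mono)
  qed
  then show ?thesis
    by (auto simp: Linf_def)
qed

lemma (in mp_system) L2_T_pow:
  assumes "f \<in> L2 M"
  shows "(\<lambda>x. f ((T ^^ n) x)) \<in> L2 M"
  using assms integrable_T_pow[of "\<lambda>x. (cmod (f x))\<^sup>2" n] by (auto simp: L2_def)

lemma L2_cnj: "f \<in> L2 M \<Longrightarrow> (\<lambda>x. cnj (f x)) \<in> L2 M"
  by (auto simp: L2_def)

section \<open>Mixing, Host-Kra seminorms and the dense set\<close>

context kolmogorov_filtration
begin

text \<open>Replace \<open>f\<close> by an innovation \<open>s\<close> close to it in L^2. The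
  correlations of \<open>s\<close> vanish from lag \<open>L\<close> on, and the two error terms are
  small uniformly in the lag.\<close>

lemma mixing_centered:
  assumes f: "f \<in> L2 M" and "(LINT x|M. f x) = 0"
  shows "(\<lambda>h. LINT x|M. f x * cnj (f ((T ^^ h) x))) \<longlonglongrightarrow> 0"
proof (rule LIMSEQ_I)
  fix e :: real
  assume "e > 0"
  \<comment> \<open>Bounds the squared norms of both \<open>f\<close> and \<open>s\<close>; the
    summand 2 pays for the distance between them, as \<open>\<eta> \<le> 1\<close>.\<close>
  define K where "K = 2 * (LINT x|M. (cmod (f x))\<^sup>2) + 2"
  have If: "(LINT x|M. (cmod (f x))\<^sup>2) \<ge> 0"
    by simp
  then have "K \<ge> 2"
    by (simp add: K_def)
  define \<eta> where "\<eta> = min 1 (e / (2 * (K + 1)))"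
  have \<eta>: "\<eta> > 0" "\<eta> \<le> 1" "\<eta> * (K + 1) < e"
  proof -
    show "\<eta> > 0" "\<eta> \<le> 1"
      using \<open>e > 0\<close> \<open>K \<ge> 2\<close> by (auto simp: \<eta>_def)
    have "\<eta> * (K + 1) \<le> e / (2 * (K + 1)) * (K + 1)"
      using \<open>K \<ge> 2\<close> by (intro mult_right_mono) (auto simp: \<eta>_def)
    also have "\<dots> = e / 2"
      using \<open>K \<ge> 2\<close> by (simp add: field_simps)
    also have "\<dots> < e"
      using \<open>e > 0\<close> by simp
    finally show "\<eta> * (K + 1) < e" .
  qed
  have "\<eta>\<^sup>2 > 0"
    using \<eta> by simp
  from innov_dense[OF assms this] obtain n L s where s: "s \<in> innov n L"
    and fs: "(LINT x|M. (cmod (f x - s x))\<^sup>2) < \<eta>\<^sup>2"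
    by blast
  have sL2: "s \<in> L2 M"
    by (rule innov_L2[OF s])
  define d where "d x = f x - s x" for x
  have dL2: "d \<in> L2 M"
    unfolding d_def by (intro L2_diff f sL2)
  have d: "(LINT x|M. (cmod (d x))\<^sup>2) \<le> \<eta>\<^sup>2"
    using fs by (simp add: d_def)
  have fK: "(LINT x|M. (cmod (f x))\<^sup>2) \<le> K"
    using If by (simp add: K_def)
  have "(LINT x|M. (cmod (s x))\<^sup>2) = (LINT x|M. (cmod (f x + (-1) * d x))\<^sup>2)"
    by (simp add: d_def)
  also have "\<dots> \<le> 2 * (LINT x|M. (cmod (f x))\<^sup>2) + 2 * (LINT x|M. (cmod ((-1) * d x))\<^sup>2)"
    by (intro integral_norm_add_square_le f L2_mult_const dL2)
  also have "\<dots> \<le> K"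
    using d power_mono[OF \<eta>(2), of 2] \<eta>(1) by (simp add: K_def)
  finally have sK: "(LINT x|M. (cmod (s x))\<^sup>2) \<le> K" .
  have "cmod (LINT x|M. f x * cnj (f ((T ^^ h) x))) < e" if "h \<ge> L" for h
  proof -
    have [measurable]: "f \<in> borel_measurable M" "d \<in> borel_measurable M" "s \<in> borel_measurable M"
      using f dL2 sL2 by (auto simp: L2_def)
    have inv: "(LINT x|M. (cmod (g ((T ^^ h) x)))\<^sup>2) = (LINT x|M. (cmod (g x))\<^sup>2)"
      if "g \<in> borel_measurable M" for g
      using integral_T_pow[of "\<lambda>x. (cmod (g x))\<^sup>2" h] that by simp
    note 1 = integral_mult_le_weighted[OF dL2 L2_cnj[OF L2_T_pow[OF f]] \<eta>(1) d, of h K]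
    note 2 = integral_mult_le_weighted[OF L2_cnj[OF L2_T_pow[OF dL2]] sL2 \<eta>(1) _ sK, of h]
    have zero: "(LINT x|M. s x * cnj (s ((T ^^ h) x))) = 0"
      using invariant_subalgebra.innovation_gap[OF invariant_subalgebra_B s that, of 0] by simp
    have i3: "integrable M (\<lambda>x. s x * cnj (s ((T ^^ h) x)))"
    proof -
      have "bounded (range s)"
        using s by (auto simp: innov_def)
      then have "bounded (range (\<lambda>x. s x * cnj (s ((T ^^ h) x))))"
        by (intro bounded_range_mult bounded_range_cnj bounded_range_compose[of s "T ^^ h"])
      then show ?thesis
        by (rule integrable_bounded_range[rotated]) measurable
    qed
    \<comment> \<open>Replace first the unshifted factor \<open>f\<close> by \<open>d + s\<close>,
      then the shifted factor in the part with \<open>s\<close>.\<close>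
    have "(LINT x|M. f x * cnj (f ((T ^^ h) x)))
        = (LINT x|M. (d x * cnj (f ((T ^^ h) x)) + cnj (d ((T ^^ h) x)) * s x) + s x * cnj (s ((T ^^ h) x)))"
      by (intro Bochner_Integration.integral_cong refl) (simp add: d_def algebra_simps)
    also have "\<dots> = (LINT x|M. d x * cnj (f ((T ^^ h) x))) + (LINT x|M. cnj (d ((T ^^ h) x)) * s x)"
      using 1(2) 2(2) i3 zero fK d by (simp add: inv)
    finally have "cmod (LINT x|M. f x * cnj (f ((T ^^ h) x)))
        \<le> cmod (LINT x|M. d x * cnj (f ((T ^^ h) x))) + cmod (LINT x|M. cnj (d ((T ^^ h) x)) * s x)"
      by (simp add: norm_triangle_ineq)
    also have "\<dots> \<le> \<eta> * (K + 1) / 2 + \<eta> * (K + 1) / 2"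
      using 1(1) 2(1) fK d by (intro add_mono) (simp_all add: inv)
    also have "\<dots> < e"
      using \<eta>(3) by simp
    finally show ?thesis .
  qed
  then show "\<exists>no. \<forall>h\<ge>no. norm ((LINT x|M. f x * cnj (f ((T ^^ h) x))) - 0) < e"
    by auto
qed

text \<open>Subtract the mean \<open>c\<close>: the cross terms have integral zero and
  \<open>c * cnj c\<close> remains.\<close>

lemma mixing:
  assumes f: "f \<in> L2 M"
  shows "(\<lambda>h. cmod (LINT x|M. f x * cnj (f ((T ^^ h) x)))) \<longlonglongrightarrow> (cmod (LINT x|M. f x))\<^sup>2"
proof -
  define c where "c = (LINT x|M. f x)"
  define g where "g x = f x - c" for x
  have gL2: "g \<in> L2 M"
    unfolding g_def by (intro L2_diff f L2_const)
  have int: "integrable M f" "integrable M g"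
    using f gL2 by (auto intro: L2_integrable)
  have g0: "(LINT x|M. g x) = 0"
    using int by (simp add: g_def prob_space c_def)
  have [measurable]: "g \<in> borel_measurable M"
    using gL2 by (auto simp: L2_def)
  have "(LINT x|M. f x * cnj (f ((T ^^ h) x))) = (LINT x|M. g x * cnj (g ((T ^^ h) x))) + c * cnj c" for h
  proof -
    \<comment> \<open>Only the integrability part is used; the weight is any positive number whose
      square exceeds the squared norm.\<close>
    have i1: "integrable M (\<lambda>x. g x * cnj (g ((T ^^ h) x)))"
    proof (rule integral_mult_le_weighted(2)[OF gL2 L2_cnj[OF L2_T_pow[OF gL2]] _ _ order_refl])
      show "(LINT x|M. (cmod (g x))\<^sup>2) \<le> (sqrt ((LINT x|M. (cmod (g x))\<^sup>2) + 1))\<^sup>2"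
        by simp
      show "sqrt ((LINT x|M. (cmod (g x))\<^sup>2) + 1) > 0"
        by (simp add: add_nonneg_pos)
    qed
    have i2: "integrable M (\<lambda>x. cnj (g ((T ^^ h) x)))"
      using integrable_T_pow[OF int(2)] by simp
    have "(LINT x|M. cnj (g ((T ^^ h) x))) = 0"
      using integral_T_pow[of g h] g0 by simp
    have "(LINT x|M. f x * cnj (f ((T ^^ h) x)))
        = (LINT x|M. g x * cnj (g ((T ^^ h) x)) + (g x * cnj c + (c * cnj (g ((T ^^ h) x)) + c * cnj c)))"
      by (intro Bochner_Integration.integral_cong refl) (simp add: g_def algebra_simps)
    also have "\<dots> = (LINT x|M. g x * cnj (g ((T ^^ h) x))) + ((LINT x|M. g x) * cnj c + (c * (LINT x|M. cnj (g ((T ^^ h) x))) + c * cnj c))"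
      using i1 i2 int(2) by (simp add: prob_space)
    finally show ?thesis
      using g0 \<open>(LINT x|M. cnj (g ((T ^^ h) x))) = 0\<close> by simp
  qed
  moreover have "(\<lambda>h. cmod ((LINT x|M. g x * cnj (g ((T ^^ h) x))) + c * cnj c)) \<longlonglongrightarrow> cmod (0 + c * cnj c)"
    by (intro tendsto_intros mixing_centered gL2 g0)
  ultimately show ?thesis
    by (simp add: c_def norm_mult power2_eq_square)
qed

text \<open>By induction the inner seminorm at lag \<open>h\<close> is the modulus of a correlation,
  which by mixing tends to the square of the modulus of the mean. Cesaro averages inherit the limit,
  and the root cancels the exponent \<open>2 ^ (k + 2)\<close>.\<close>

lemma hk_seminorm_eq:
  assumes "f \<in> Linf M"
  shows "hk_seminorm M T (Suc k) f = cmod (LINT x|M. f x)"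
  using assms
proof (induction k arbitrary: f)
  case (Suc k)
  let ?c = "cmod (LINT x|M. f x)"
  let ?q = "\<lambda>h. cmod (LINT x|M. f x * cnj (f ((T ^^ h) x)))"
  have "(\<lambda>h. ?q h ^ 2 ^ (k + 1)) \<longlonglongrightarrow> (?c\<^sup>2) ^ 2 ^ (k + 1)"
    by (intro tendsto_intros mixing Linf_L2 Suc.prems)
  then have "(\<lambda>H. (1 / real H) * (\<Sum>h=1..H. ?q h ^ 2 ^ (k + 1))) \<longlonglongrightarrow> (?c\<^sup>2) ^ 2 ^ (k + 1)"
    by (rule cesaro_mean_tendsto)
  then have "lim (\<lambda>H. (1 / real H) * (\<Sum>h=1..H. ?q h ^ 2 ^ (k + 1))) = (?c\<^sup>2) ^ 2 ^ (k + 1)"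
    by (rule limI)
  moreover have "hk_seminorm M T (Suc k) (\<lambda>x. f x * cnj (f ((T ^^ h) x))) = ?q h" for h
    by (intro Suc.IH Linf_correlation Suc.prems)
  ultimately have "hk_seminorm M T (Suc (Suc k)) f = root (2 ^ (k + 2)) ((?c\<^sup>2) ^ 2 ^ (k + 1))"
    by (simp only: hk_seminorm.simps)
  also have "(?c\<^sup>2) ^ 2 ^ (k + 1) = ?c ^ 2 ^ (k + 2)"
    by (simp flip: power_mult)
  also have "root (2 ^ (k + 2)) (?c ^ 2 ^ (k + 2)) = ?c"
    by (rule real_root_power_cancel) auto
  finally show ?case .
qed simp

text \<open>Both sides of the characterization reduce to the vanishing of the integral of
  \<open>f\<close>.\<close>

lemma hkz_factor_trivial_alg: "hkz_factor M T k trivial_alg"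
proof -
  have "subalgebra M trivial_alg"
    by (auto simp: subalgebra_def trivial_alg)
  moreover have "preimage_sets M T 1 trivial_alg \<subseteq> sets trivial_alg"
    using T_pow_space[of _ 1] by (auto simp: preimage_sets_def trivial_alg)
  moreover have "(AE x in M. complex_cond_exp M trivial_alg f x = 0) \<longleftrightarrow> hk_seminorm M T (k + 1) f = 0"
    if "f \<in> Linf M" for f
    using complex_cond_exp_trivial_alg[OF L2_integrable[OF Linf_L2[OF that]]] hk_seminorm_eq[OF that, of k] by simp
  ultimately show ?thesis
    unfolding hkz_factor_def by blast
qed

lemma L2_perp_trivial_alg: "L2_perp M trivial_alg = {f \<in> L2 M. (LINT x|M. f x) = 0}"
  using complex_cond_exp_trivial_alg[OF L2_integrable] by (auto simp: L2_perp_def)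

lemma innov_L2_dense_in: "L2_dense_in M (\<Union>n L. innov n L) (L2_perp M trivial_alg)"
  unfolding L2_dense_in_def
proof (intro conjI ballI allI impI)
  show "(\<Union>n L. innov n L) \<subseteq> L2_perp M trivial_alg"
    unfolding L2_perp_trivial_alg
    using innov_L2 invariant_subalgebra.innovation_integral[OF invariant_subalgebra_B] by blast
next
  fix g and e :: real
  assume g: "g \<in> L2_perp M trivial_alg" and "e > 0"
  then have "e\<^sup>2 > 0"
    by simp
  from g have g': "g \<in> L2 M" "(LINT x|M. g x) = 0"
    by (auto simp: L2_perp_trivial_alg)
  obtain n L f where f: "f \<in> innov n L" "(LINT x|M. (cmod (g x - f x))\<^sup>2) < e\<^sup>2"
    using innov_dense[OF g' \<open>e\<^sup>2 > 0\<close>] by blast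
  have "Lp_norm M 2 (\<lambda>x. g x - f x) = sqrt (LINT x|M. (cmod (g x - f x))\<^sup>2)"
    by (simp add: Lp_norm_def powr_half_sqrt)
  also have "\<dots> < e"
    using f(2) \<open>e > 0\<close> by (intro real_less_lsqrt) auto
  finally show "\<exists>f\<in>\<Union>n L. innov n L. Lp_norm M 2 (\<lambda>x. g x - f x) < e"
    using f(1) by blast
qed

text \<open>One dense set, all innovations of all levels, and one exponent serve every order
  \<open>J\<close>.\<close>

lemma ww_system_type_if_ergodic:
  assumes "ergodic_system M T" "J \<ge> 1"
  shows "ww_system_type M T J (1/6) 2"
  unfolding ww_system_type_def
proof (intro conjI exI ballI)
  fix f
  assume "f \<in> (\<Union>n L. innov n L)"
  then show "ww_function M T J (1/6) 2 f"
    using invariant_subalgebra.innovation_ww_function[OF invariant_subalgebra_B _ assms(2)] by auto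
qed (rule assms(1) hkz_factor_trivial_alg innov_L2_dense_in)+

end

theorem corollary4p3:
  fixes M :: "'a measure" and T :: "'a \<Rightarrow> 'a"
  assumes "kolmogorov_system M T"
  shows "\<forall>J::nat. J \<ge> 1 \<longrightarrow> ww_system M T J"
proof (intro allI impI)
  fix J :: nat
  assume "J \<ge> 1"
  interpret kolmogorov_system M T
    by (rule assms)
  obtain A where A: "subalgebra M A" "preimage_sets M T 1 A \<subseteq> sets A"
    "\<forall>D\<in>(\<Inter>n. preimage_sets M T n A). prob D = 0 \<or> prob D = 1"
    "\<forall>D\<in>sets M. \<exists>C\<in>sigma_sets (space M) (\<Union>n. image_sets T n A). (D - C) \<union> (C - D) \<in> null_sets M"
    using kolmogorov by blast
  have sp: "space A = space M"
    using A(1) by (simp add: subalgebra_def)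
  interpret kolmogorov_filtration M T A
  proof
    \<comment> \<open>The clause on preimages for \<open>n = 1\<close> is exactly this
      measurability.\<close>
    show "T \<in> measurable A A"
    proof (rule measurableI)
      show "T x \<in> space A" if "x \<in> space A" for x
        using that measurable_space[OF T_measurable] by (simp add: sp)
      show "T -` E \<inter> space A \<in> sets A" if "E \<in> sets A" for E
        using A(2) that by (auto simp: preimage_sets_def sp)
    qed
    show "prob D = 0 \<or> prob D = 1" if "\<And>n. \<exists>E\<in>sets A. D = (T ^^ n) -` E \<inter> space M" for D
    proof (rule bspec[OF A(3)])
      show "D \<in> (\<Inter>n. preimage_sets M T n A)"
        unfolding preimage_sets_def using that by blast
    qed
  qed (use A in auto)
  have "ww_system_type M T J (1/6) 2"
    by (rule ww_system_type_if_ergodic[OF _ \<open>J \<ge> 1\<close>]) unfold_locales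
  then show "ww_system M T J"
    unfolding ww_system_def by (intro exI[of _ "1/6"] exI[of _ 2] conjI) auto
qed

end
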